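(* Let $\mathfrak g$ be one of the following real Lie algebras, assumed to be simple, acting in its defining representation on $M$. (a) In each of the cases (1) $\mathfrak g=so(n,\mathbb R)$, $M=\mathbb R^n$; (2) $\mathfrak g=sl(n,\mathbb R)$, $M=\mathbb R^n$; (3) $\mathfrak g=sp(n,\mathbb R)$, $M=\mathbb R^{2n}$: for any classical $r$-matrix $r\in\bigwedge^2\mathfrak g$, the fundamental bi-vector field $r_M$ on $M$ is Poisson. (b) For $\mathfrak g=su(n)$, $M=\mathbb C^n=\mathbb R^{2n}$ (as a real manifold), and any classical $r$-matrix $r\in\bigwedge^2\mathfrak g$: $r_M$ is Poisson if and only if $r$ is triangular.
   Context: A classical $r$-matrix on a Lie algebra $\mathfrak g$ is an element $r\in\bigwedge^2\mathfrak g$ such that the (algebraic) Schouten bracket $[r,r]\in\bigwedge^3\mathfrak g$ is $\mathfrak g$-invariant; it is triangular if $[r,r]=0$. For the linear action of $\mathfrak g$ on the real vector space $M$, and $r=\sum_i X_i\wedge Y_i$ with $X_i,Y_i\in\mathfrak g$, the fundamental bi-vector field is $r_M(x)=\sum_i (X_ix)\wedge(Y_ix)$, $x\in M$. A bi-vector field is Poisson if its Schouten bracket with itself vanishes. Here $so(n,\mathbb R)$ is the Lie algebra of skew-symmetric real $n\times n$ matrices, $sp(n,\mathbb R)$ is the Lie algebra of real $2n\times 2n$ matrices preserving the standard symplectic form on $\mathbb R^{2n}$, and $su(n)$ is the real Lie algebra of traceless anti-Hermitian complex $n\times n$ matrices. *)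

theory Defs
  imports "HOL-Analysis.Analysis"
begin

section \<open>Bivectors and trivectors\<close>

text \<open>
  For a finite-dimensional real vector space \<open>V\<close>, tensors in \<open>V \<otimes> V\<close> and \<open>V \<otimes> V \<otimes> V\<close> are
  represented as (automatically bounded) multilinear forms on the dual space \<open>V*\<close>. The exterior
  powers of a subspace of \<open>V\<close> are the subspaces spanned by the decomposable elements, where
  \<open>(X \<and> Y)(\<alpha>, \<beta>) = \<alpha>(X) \<beta>(Y) - \<alpha>(Y) \<beta>(X)\<close> and
  \<open>(X \<and> Y \<and> Z)(\<alpha>, \<beta>, \<gamma>)\<close> is the determinant of the pairings.
\<close>

type_synonym 'v dual = "'v \<Rightarrow>\<^sub>L real"
type_synonym 'v tensor2 = "'v dual \<Rightarrow>\<^sub>L 'v dual \<Rightarrow>\<^sub>L real"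
type_synonym 'v tensor3 = "'v dual \<Rightarrow>\<^sub>L 'v dual \<Rightarrow>\<^sub>L 'v dual \<Rightarrow>\<^sub>L real"

definition eval_at :: "'v::real_normed_vector \<Rightarrow> 'v dual \<Rightarrow>\<^sub>L real" where
  "eval_at X = Blinfun (\<lambda>\<alpha>. blinfun_apply \<alpha> X)"

definition tensor :: "'v::real_normed_vector \<Rightarrow> 'w::real_normed_vector \<Rightarrow> 'v dual \<Rightarrow>\<^sub>L 'w" where
  "tensor X w = Blinfun (\<lambda>\<alpha>. blinfun_apply \<alpha> X *\<^sub>R w)"

definition wedge2 :: "'v::real_normed_vector \<Rightarrow> 'v \<Rightarrow> 'v tensor2" where
  "wedge2 X Y = tensor X (eval_at Y) - tensor Y (eval_at X)"

definition wedge3 :: "'v::real_normed_vector \<Rightarrow> 'v \<Rightarrow> 'v \<Rightarrow> 'v tensor3" where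
  "wedge3 X Y Z = tensor X (wedge2 Y Z) + tensor Y (wedge2 Z X) + tensor Z (wedge2 X Y)"

definition Wedge2 :: "'v::real_normed_vector set \<Rightarrow> 'v tensor2 set" where
  "Wedge2 V = span {wedge2 X Y | X Y. X \<in> V \<and> Y \<in> V}"

text \<open>Coefficients of a tensor with respect to the standard basis.\<close>

definition coeff2 :: "'v::euclidean_space tensor2 \<Rightarrow> 'v \<Rightarrow> 'v \<Rightarrow> real" where
  "coeff2 r a b = blinfun_apply (blinfun_apply r (blinfun_inner_left a)) (blinfun_inner_left b)"

definition coeff3 :: "'v::euclidean_space tensor3 \<Rightarrow> 'v \<Rightarrow> 'v \<Rightarrow> 'v \<Rightarrow> real" where
  "coeff3 t a b c = coeff2 (blinfun_apply t (blinfun_inner_left a)) b c"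

text \<open>
  The linear maps on the exterior powers induced by alternating multilinear maps (the universal
  property of the exterior powers), using \<open>r = 1/2 \<Sum>\<^sub>a\<^sub>b r\<^sub>a\<^sub>b a \<and> b\<close> and
  \<open>t = 1/6 \<Sum>\<^sub>a\<^sub>b\<^sub>c t\<^sub>a\<^sub>b\<^sub>c a \<and> b \<and> c\<close>. See \<open>ext2_wedge2\<close> and \<open>ext3_wedge3\<close> below.
\<close>

definition ext2 :: "('v::euclidean_space \<Rightarrow> 'v \<Rightarrow> 'w::real_vector) \<Rightarrow> 'v tensor2 \<Rightarrow> 'w" where
  "ext2 f r = (1/2) *\<^sub>R (\<Sum>a\<in>Basis. \<Sum>b\<in>Basis. coeff2 r a b *\<^sub>R f a b)"

definition ext3 :: "('v::euclidean_space \<Rightarrow> 'v \<Rightarrow> 'v \<Rightarrow> 'w::real_vector) \<Rightarrow> 'v tensor3 \<Rightarrow> 'w" where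
  "ext3 f t = (1/6) *\<^sub>R (\<Sum>a\<in>Basis. \<Sum>b\<in>Basis. \<Sum>c\<in>Basis. coeff3 t a b c *\<^sub>R f a b c)"

lemma eval_at_apply [simp]: "blinfun_apply (eval_at X) \<alpha> = blinfun_apply \<alpha> X"
  unfolding eval_at_def
  by (subst bounded_linear_Blinfun_apply) (auto intro!: bounded_linear_intros)

lemma tensor_apply [simp]: "blinfun_apply (tensor X w) \<alpha> = blinfun_apply \<alpha> X *\<^sub>R w"
  unfolding tensor_def
  by (subst bounded_linear_Blinfun_apply) (auto intro!: bounded_linear_intros)

lemma wedge2_apply:
  "blinfun_apply (blinfun_apply (wedge2 X Y) \<alpha>) \<beta> =
     blinfun_apply \<alpha> X * blinfun_apply \<beta> Y - blinfun_apply \<alpha> Y * blinfun_apply \<beta> X"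
  by (simp add: wedge2_def blinfun.diff_left blinfun.scaleR_left)

lemma wedge3_apply:
  "blinfun_apply (blinfun_apply (blinfun_apply (wedge3 X Y Z) \<alpha>) \<beta>) \<gamma> =
     blinfun_apply \<alpha> X * (blinfun_apply \<beta> Y * blinfun_apply \<gamma> Z - blinfun_apply \<beta> Z * blinfun_apply \<gamma> Y)
   + blinfun_apply \<alpha> Y * (blinfun_apply \<beta> Z * blinfun_apply \<gamma> X - blinfun_apply \<beta> X * blinfun_apply \<gamma> Z)
   + blinfun_apply \<alpha> Z * (blinfun_apply \<beta> X * blinfun_apply \<gamma> Y - blinfun_apply \<beta> Y * blinfun_apply \<gamma> X)"
  by (simp add: wedge3_def wedge2_apply blinfun.add_left blinfun.scaleR_left)

lemma bilinear_wedge2: "bilinear wedge2"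
  by (auto simp: bilinear_def wedge2_apply blinfun.add_right blinfun.scaleR_right
      blinfun.add_left blinfun.scaleR_left algebra_simps intro!: linearI blinfun_eqI)

lemma wedge2_self [simp]: "wedge2 X X = 0"
  by (simp add: wedge2_def)

lemma wedge3_linear:
  "linear (\<lambda>X. wedge3 X Y Z)" "linear (\<lambda>Y. wedge3 X Y Z)" "linear (\<lambda>Z. wedge3 X Y Z)"
  by (auto simp: wedge3_apply blinfun.add_right blinfun.scaleR_right
      blinfun.add_left blinfun.scaleR_left algebra_simps intro!: linearI blinfun_eqI)

lemma wedge3_self [simp]: "wedge3 X X Z = 0" "wedge3 X Z X = 0" "wedge3 Z X X = 0"
  by (auto simp: wedge3_apply algebra_simps intro!: blinfun_eqI)

lemma ext2_linear: "linear (ext2 f)"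
  by (auto simp: ext2_def coeff2_def blinfun.add_left blinfun.scaleR_left scaleR_add_left
      sum.distrib scaleR_add_right scaleR_sum_right mult.left_commute mult.assoc intro!: linearI)

lemma ext3_linear: "linear (ext3 f)"
  by (auto simp: ext3_def coeff3_def coeff2_def blinfun.add_left blinfun.scaleR_left scaleR_add_left
      sum.distrib scaleR_add_right scaleR_sum_right mult.left_commute mult.assoc intro!: linearI)

lemma sum_Basis_linear:
  assumes "linear f"
  shows "(\<Sum>a\<in>Basis. (x \<bullet> a) *\<^sub>R f a) = f x"
proof -
  have "f x = f (\<Sum>a\<in>Basis. (x \<bullet> a) *\<^sub>R a)"
    by (simp add: euclidean_representation)
  then show ?thesis
    by (simp add: linear_sum[OF assms] linear_cmul[OF assms])
qed

lemma sum_Basis_bilinear: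
  assumes "bilinear f"
  shows "(\<Sum>a\<in>Basis. \<Sum>b\<in>Basis. ((X \<bullet> a) * (Y \<bullet> b)) *\<^sub>R f a b) = f X Y"
proof -
  have "linear (f a)" "linear (\<lambda>x. f x b)" for a b
    using assms by (auto simp: bilinear_def)
  then show ?thesis
    by (simp flip: scaleR_scaleR scaleR_sum_right add: sum_Basis_linear)
qed

lemma ext2_wedge2:
  assumes f: "bilinear f" and alt: "\<And>x. f x x = 0"
  shows "ext2 f (wedge2 X Y) = f X Y"
proof -
  have "f X X + f Y X + (f X Y + f Y Y) = 0"
    using alt[of "X + Y"] by (simp only: bilinear_ladd[OF f] bilinear_radd[OF f])
  then have "f Y X + f X Y = 0"
    by (simp add: alt)
  then have anti: "f Y X = - f X Y"
    by (simp only: eq_neg_iff_add_eq_0)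
  have "ext2 f (wedge2 X Y) = (1/2) *\<^sub>R (f X Y - f Y X)"
    by (simp add: ext2_def coeff2_def wedge2_apply scaleR_diff_left sum_subtractf
        sum_Basis_bilinear[OF f])
  also have "\<dots> = f X Y"
    by (simp add: anti flip: scaleR_2)
  finally show ?thesis .
qed

lemma sum_Basis_trilinear:
  assumes 1: "\<And>y z. linear (\<lambda>x. f x y z)" and 2: "\<And>x. bilinear (f x)"
  shows "(\<Sum>a\<in>Basis. \<Sum>b\<in>Basis. \<Sum>c\<in>Basis. ((X \<bullet> a) * ((Y \<bullet> b) * (Z \<bullet> c))) *\<^sub>R f a b c) = f X Y Z"
  using sum_Basis_linear[OF 1]
  by (simp flip: scaleR_scaleR scaleR_sum_right
      add: sum_Basis_bilinear[OF 2, unfolded scaleR_scaleR[symmetric] scaleR_sum_right[symmetric]])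

lemma ext3_wedge3:
  assumes 1: "\<And>y z. linear (\<lambda>x. f x y z)" and 2: "\<And>x. bilinear (f x)"
    and alt: "\<And>x y. f x x y = 0" "\<And>x y. f x y y = 0"
  shows "ext3 f (wedge3 X Y Z) = f X Y Z"
proof -
  have l: "f (x + x') y z = f x y z + f x' y z" for x x' y z
    using linear_add[OF 1] .
  have a1: "f y x z = - f x y z" for x y z
  proof -
    have "f x x z + f y x z + (f x y z + f y y z) = 0"
      using alt(1)[of "x + y" z] by (simp only: l bilinear_ladd[OF 2])
    then show ?thesis by (simp add: alt eq_neg_iff_add_eq_0)
  qed
  have a2: "f x z y = - f x y z" for x y z
  proof -
    have "f x y y + f x z y + (f x y z + f x z z) = 0"
      using alt(2)[of x "y + z"] by (simp only: bilinear_radd[OF 2] bilinear_ladd[OF 2])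
    then show ?thesis by (simp add: alt eq_neg_iff_add_eq_0)
  qed
  have e: "f X Z Y = - f X Y Z" "f Y Z X = f X Y Z" "f Y X Z = - f X Y Z"
    "f Z X Y = f X Y Z" "f Z Y X = - f X Y Z"
    by (metis a1 a2 minus_minus)+
  have "ext3 f (wedge3 X Y Z) =
     (1/6) *\<^sub>R (f X Y Z - f X Z Y + (f Y Z X - f Y X Z) + (f Z X Y - f Z Y X))"
    by (simp add: ext3_def coeff3_def coeff2_def wedge3_apply right_diff_distrib scaleR_diff_left
        scaleR_add_left sum_subtractf sum.distrib sum_Basis_trilinear[of f, OF 1 2])
  also have "f X Y Z - f X Z Y + (f Y Z X - f Y X Z) + (f Z X Y - f Z Y X) = 6 *\<^sub>R f X Y Z"
    by (simp add: e) (simp flip: scaleR_2 scaleR_left.add)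
  finally show ?thesis by simp
qed


section \<open>The algebraic Schouten bracket and classical r-matrices\<close>

definition lie_bracket :: "'a::ring_1^'n^'n \<Rightarrow> 'a^'n^'n \<Rightarrow> 'a^'n^'n" where
  "lie_bracket A B = A ** B - B ** A"

text \<open>
  On decomposable elements, the Schouten bracket is
  \<open>[X\<^sub>1 \<and> X\<^sub>2, Y\<^sub>1 \<and> Y\<^sub>2] = \<Sum>\<^sub>i\<^sub>j (-1)\<^sup>i\<^sup>+\<^sup>j [X\<^sub>i, Y\<^sub>j] \<and> X' \<and> Y'\<close>, where \<open>X'\<close>, \<open>Y'\<close> are the factors other than
  \<open>X\<^sub>i\<close>, \<open>Y\<^sub>j\<close>; it is extended bilinearly.
\<close>

definition schouten_decomposable ::
  "'a::{real_normed_field,euclidean_space}^'n^'n \<Rightarrow> 'a^'n^'n \<Rightarrow> 'a^'n^'n \<Rightarrow> 'a^'n^'n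
     \<Rightarrow> ('a^'n^'n) tensor3" where
  "schouten_decomposable X1 X2 Y1 Y2 =
       wedge3 (lie_bracket X1 Y1) X2 Y2 - wedge3 (lie_bracket X1 Y2) X2 Y1
     - wedge3 (lie_bracket X2 Y1) X1 Y2 + wedge3 (lie_bracket X2 Y2) X1 Y1"

definition schouten ::
  "('a::{real_normed_field,euclidean_space}^'n^'n) tensor2 \<Rightarrow> ('a^'n^'n) tensor2
     \<Rightarrow> ('a^'n^'n) tensor3" where
  "schouten r s = ext2 (\<lambda>X1 X2. ext2 (\<lambda>Y1 Y2. schouten_decomposable X1 X2 Y1 Y2) s) r"

definition ad3 ::
  "'a::{real_normed_field,euclidean_space}^'n^'n \<Rightarrow> ('a^'n^'n) tensor3 \<Rightarrow> ('a^'n^'n) tensor3" where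
  "ad3 Z = ext3 (\<lambda>X Y W. wedge3 (lie_bracket Z X) Y W + wedge3 X (lie_bracket Z Y) W
                        + wedge3 X Y (lie_bracket Z W))"

definition classical_r_matrix ::
  "('a::{real_normed_field,euclidean_space}^'n^'n) set \<Rightarrow> ('a^'n^'n) tensor2 \<Rightarrow> bool" where
  "classical_r_matrix \<gg> r \<longleftrightarrow> r \<in> Wedge2 \<gg> \<and> (\<forall>Z\<in>\<gg>. ad3 Z (schouten r r) = 0)"

definition triangular ::
  "('a::{real_normed_field,euclidean_space}^'n^'n) tensor2 \<Rightarrow> bool" where
  "triangular r \<longleftrightarrow> schouten r r = 0"

lemma lie_bracket_bilinear:
  "bilinear (lie_bracket :: 'a::real_normed_field^'n^'n \<Rightarrow> _)"
  by (auto simp: bilinear_def lie_bracket_def matrix_matrix_mult_def vec_eq_iff sum.distrib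
      algebra_simps scaleR_sum_right intro!: linearI)

lemma lie_bracket_linear:
  "linear (\<lambda>X. lie_bracket X Y)" "linear (lie_bracket (Y :: 'a::real_normed_field^'n^'n))"
  using lie_bracket_bilinear by (auto simp: bilinear_def)

lemma schouten_decomposable_linear:
  "linear (\<lambda>X1. schouten_decomposable X1 X2 Y1 Y2)" "linear (\<lambda>X2. schouten_decomposable X1 X2 Y1 Y2)"
  "linear (\<lambda>Y1. schouten_decomposable X1 X2 Y1 Y2)" "linear (\<lambda>Y2. schouten_decomposable X1 X2 Y1 Y2)"
  unfolding schouten_decomposable_def
  by (intro linear_compose_sub linear_compose_add wedge3_linear
      linear_compose[OF lie_bracket_linear(1) wedge3_linear(1), unfolded o_def]
      linear_compose[OF lie_bracket_linear(2) wedge3_linear(1), unfolded o_def])+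

lemma schouten_wedge2:
  "schouten (wedge2 X1 X2) (wedge2 Y1 Y2) = schouten_decomposable X1 X2 Y1 Y2"
proof -
  have in1: "ext2 (\<lambda>Y1 Y2. schouten_decomposable X1 X2 Y1 Y2) (wedge2 Y1 Y2) =
      schouten_decomposable X1 X2 Y1 Y2" for X1 X2 :: "'a^'b^'b"
    by (rule ext2_wedge2)
      (auto simp: bilinear_def schouten_decomposable_linear, simp add: schouten_decomposable_def)
  show ?thesis
    unfolding schouten_def in1
    by (rule ext2_wedge2)
      (auto simp: bilinear_def schouten_decomposable_linear, simp add: schouten_decomposable_def)
qed

lemma schouten_bilinear: "bilinear schouten"
proof -
  have "linear (\<lambda>r. schouten r s)" for s :: "('a^'b^'b) tensor2"
    unfolding schouten_def by (rule ext2_linear)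
  moreover have "linear (\<lambda>s. schouten r s)" for r :: "('a^'b^'b) tensor2"
    unfolding schouten_def ext2_def[of "\<lambda>X1 X2. ext2 (\<lambda>Y1 Y2. schouten_decomposable X1 X2 Y1 Y2) _"]
    by (intro linear_compose_scale_right linear_compose_sum ballI ext2_linear)
  ultimately show ?thesis by (simp add: bilinear_def)
qed

lemma ad3_wedge3:
  "ad3 Z (wedge3 X Y W) = wedge3 (lie_bracket Z X) Y W + wedge3 X (lie_bracket Z Y) W
                        + wedge3 X Y (lie_bracket Z W)"
proof -
  have s: "wedge3 A B C = - wedge3 B A C" "wedge3 A B C = - wedge3 A C B" for A B C :: "'a^'b^'b"
    by (auto simp: wedge3_apply blinfun.minus_left algebra_simps intro!: blinfun_eqI)
  note l = linear_compose[OF lie_bracket_linear(2) wedge3_linear(1), unfolded o_def]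
    linear_compose[OF lie_bracket_linear(2) wedge3_linear(2), unfolded o_def]
    linear_compose[OF lie_bracket_linear(2) wedge3_linear(3), unfolded o_def]
  show ?thesis
    unfolding ad3_def
    apply (rule ext3_wedge3)
    subgoal by (intro linear_compose_add wedge3_linear l)
    subgoal unfolding bilinear_def by (intro conjI allI linear_compose_add wedge3_linear l)
    subgoal for x y using s(1)[of x "lie_bracket Z x" y] by simp
    subgoal for x y using s(2)[of x y "lie_bracket Z y"] by simp
    done
qed


section \<open>Bivector fields\<close>

text \<open>Vector fields on a vector space are functions from the space to itself.\<close>

definition vf_bracket ::
  "('v::euclidean_space \<Rightarrow> 'v) \<Rightarrow> ('v \<Rightarrow> 'v) \<Rightarrow> 'v \<Rightarrow> 'v" where
  "vf_bracket X Y x = frechet_derivative Y (at x) (X x) - frechet_derivative X (at x) (Y x)"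

definition vf_schouten_decomposable ::
  "('v::euclidean_space \<Rightarrow> 'v) \<Rightarrow> ('v \<Rightarrow> 'v) \<Rightarrow> ('v \<Rightarrow> 'v) \<Rightarrow> ('v \<Rightarrow> 'v) \<Rightarrow> 'v \<Rightarrow> 'v tensor3" where
  "vf_schouten_decomposable X1 X2 Y1 Y2 x =
       wedge3 (vf_bracket X1 Y1 x) (X2 x) (Y2 x) - wedge3 (vf_bracket X1 Y2 x) (X2 x) (Y1 x)
     - wedge3 (vf_bracket X2 Y1 x) (X1 x) (Y2 x) + wedge3 (vf_bracket X2 Y2 x) (X1 x) (Y1 x)"

text \<open>
  A bivector field is a sum \<open>P = 1/2 \<Sum>\<^sub>a\<^sub>b (P\<^sub>a\<^sub>b a) \<and> b\<close> of wedge products of vector fields,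
  the basis vectors \<open>b\<close> being regarded as constant vector fields; the Schouten bracket of
  two such sums is computed additively. It does not depend on the way in which the
  bivector fields are written as sums of wedge products of differentiable vector fields,
  see \<open>vf_schouten_add\<close> and \<open>vf_schouten_wedge2\<close>.
\<close>

definition vf_schouten ::
  "('v::euclidean_space \<Rightarrow> 'v tensor2) \<Rightarrow> ('v \<Rightarrow> 'v tensor2) \<Rightarrow> 'v \<Rightarrow> 'v tensor3" where
  "vf_schouten P Q x = (1/4) *\<^sub>R (\<Sum>a\<in>Basis. \<Sum>b\<in>Basis. \<Sum>c\<in>Basis. \<Sum>d\<in>Basis.
     vf_schouten_decomposable (\<lambda>y. coeff2 (P y) a b *\<^sub>R a) (\<lambda>_. b)
                              (\<lambda>y. coeff2 (Q y) c d *\<^sub>R c) (\<lambda>_. d) x)"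

definition poisson :: "('v::euclidean_space \<Rightarrow> 'v tensor2) \<Rightarrow> bool" where
  "poisson P \<longleftrightarrow> (\<forall>x. vf_schouten P P x = 0)"

text \<open>
  The linear map on bivectors induced by \<open>X \<mapsto> X x\<close>, see \<open>fundamental_field_sum\<close>.
\<close>

definition fundamental_field ::
  "('a::{real_normed_field,euclidean_space}^'n^'n) tensor2 \<Rightarrow> 'a^'n \<Rightarrow> ('a^'n) tensor2" where
  "fundamental_field r x = ext2 (\<lambda>X Y. wedge2 (X *v x) (Y *v x)) r"

lemma fundamental_field_sum:
  "fundamental_field (\<Sum>i\<in>I. wedge2 (X i) (Y i)) x = (\<Sum>i\<in>I. wedge2 (X i *v x) (Y i *v x))"
proof -
  have l: "linear (\<lambda>A :: 'a^'b^'b. A *v x)"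
    by (auto simp: matrix_vector_mult_def vec_eq_iff sum.distrib algebra_simps scaleR_sum_right
        intro!: linearI)
  have w: "linear (\<lambda>X. wedge2 X Y)" "linear (wedge2 Y)" for Y :: "'a^'b"
    using bilinear_wedge2 by (auto simp: bilinear_def)
  have "ext2 (\<lambda>X Y. wedge2 (X *v x) (Y *v x)) (wedge2 (X i) (Y i)) = wedge2 (X i *v x) (Y i *v x)" for i
    by (rule ext2_wedge2)
      (auto simp: bilinear_def linear_compose[OF l w(1), unfolded o_def]
        linear_compose[OF l w(2), unfolded o_def])
  then show ?thesis
    by (simp add: fundamental_field_def linear_sum[OF ext2_linear])
qed


lemma vf_schouten_has_derivative:
  assumes P: "(P has_derivative P') (at x)" and Q: "(Q has_derivative Q') (at x)"
  shows "vf_schouten P Q x = (1/4) *\<^sub>R (\<Sum>a\<in>Basis. \<Sum>b\<in>Basis. \<Sum>c\<in>Basis. \<Sum>d\<in>Basis.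
     (coeff2 (P x) a b * coeff2 (Q' a) c d) *\<^sub>R wedge3 c b d
     - (coeff2 (Q x) c d * coeff2 (P' c) a b) *\<^sub>R wedge3 a b d
     + (coeff2 (Q x) c d * coeff2 (P' d) a b) *\<^sub>R wedge3 a b c
     - (coeff2 (P x) a b * coeff2 (Q' b) c d) *\<^sub>R wedge3 c a d)"
proof -
  have D: "frechet_derivative (\<lambda>y. coeff2 (R y) a b *\<^sub>R a) (at x) = (\<lambda>h. coeff2 (R' h) a b *\<^sub>R a)"
    if "(R has_derivative R') (at x)" for R R' and a b :: 'a
  proof -
    have "((\<lambda>y. coeff2 (R y) a b *\<^sub>R a) has_derivative (\<lambda>h. coeff2 (R' h) a b *\<^sub>R a)) (at x)"
      unfolding coeff2_def
      by (rule bounded_linear.has_derivative[OF _ that]) (intro bounded_linear_intros)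
    then show ?thesis by (rule frechet_derivative_at[symmetric])
  qed
  have s: "R' (k *\<^sub>R h) = k *\<^sub>R R' h"
    if "(R has_derivative R') (at x)" for R :: "'a \<Rightarrow> 'a tensor2" and R' k h
    using has_derivative_linear[OF that] by (simp add: linear_cmul)
  have c: "coeff2 (k *\<^sub>R r) a b = k * coeff2 r a b" "coeff2 0 a b = 0" for k r and a b :: 'a
    by (simp_all add: coeff2_def blinfun.scaleR_left)
  have z: "P' 0 = 0" "Q' 0 = 0"
    using has_derivative_linear[OF P] has_derivative_linear[OF Q] by (simp_all add: linear_0)
  show ?thesis
    unfolding vf_schouten_def vf_schouten_decomposable_def vf_bracket_def
    by (simp add: D[OF P] D[OF Q] s[OF P] s[OF Q] c z linear_diff[OF wedge3_linear(1)]
        linear_cmul[OF wedge3_linear(1)] linear_cmul[OF wedge3_linear(2)] linear_neg[OF wedge3_linear(1)]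
        linear_cmul[OF wedge3_linear(3)] linear_0[OF wedge3_linear(1)] mult.commute)
qed

lemma vf_schouten_add:
  assumes "P1 differentiable at x" "P2 differentiable at x" "Q differentiable at x"
  shows "vf_schouten (\<lambda>y. P1 y + P2 y) Q x = vf_schouten P1 Q x + vf_schouten P2 Q x"
    and "vf_schouten Q (\<lambda>y. P1 y + P2 y) x = vf_schouten Q P1 x + vf_schouten Q P2 x"
proof -
  obtain P1' P2' Q' where P1: "(P1 has_derivative P1') (at x)" and P2: "(P2 has_derivative P2') (at x)"
    and Q: "(Q has_derivative Q') (at x)"
    using assms by (auto simp: differentiable_def)
  have c: "coeff2 (r + s) a b = coeff2 r a b + coeff2 s a b" for r s and a b :: 'a
    by (simp add: coeff2_def blinfun.add_left)
  show "vf_schouten (\<lambda>y. P1 y + P2 y) Q x = vf_schouten P1 Q x + vf_schouten P2 Q x"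
    unfolding vf_schouten_has_derivative[OF has_derivative_add[OF P1 P2] Q]
      vf_schouten_has_derivative[OF P1 Q] vf_schouten_has_derivative[OF P2 Q]
    by (simp flip: scaleR_add_right sum.distrib add: c algebra_simps)
  show "vf_schouten Q (\<lambda>y. P1 y + P2 y) x = vf_schouten Q P1 x + vf_schouten Q P2 x"
    unfolding vf_schouten_has_derivative[OF Q has_derivative_add[OF P1 P2]]
      vf_schouten_has_derivative[OF Q P1] vf_schouten_has_derivative[OF Q P2]
    by (simp flip: scaleR_add_right sum.distrib add: c algebra_simps)
qed

lemma sum_coeff2_wedge2:
  assumes f: "bilinear f"
  shows "(\<Sum>a\<in>Basis. \<Sum>b\<in>Basis. coeff2 (wedge2 X Y) a b *\<^sub>R f a b) = f X Y - f Y X"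
  by (simp add: coeff2_def wedge2_apply scaleR_diff_left sum_subtractf
      sum_Basis_bilinear[OF f])

lemma wedge3_swap:
  "wedge3 A B C = - wedge3 B A C" "wedge3 A B C = - wedge3 A C B" "wedge3 A B C = - wedge3 C B A"
  by (auto simp: wedge3_apply blinfun.minus_left algebra_simps intro!: blinfun_eqI)

lemma bounded_bilinear_wedge2:
  "bounded_bilinear (wedge2 :: 'v::euclidean_space \<Rightarrow> 'v \<Rightarrow> _)"
  using bilinear_wedge2 by (rule bilinear_conv_bounded_bilinear[THEN iffD1])

lemma fundamental_field_differentiable: "fundamental_field r differentiable at x"
proof -
  have d: "((\<lambda>x. A *v x) has_derivative (\<lambda>x. A *v x)) (at x)" for A :: "'a^'b^'b"
  proof -
    have "linear (\<lambda>x. A *v x)"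
      by (auto simp: matrix_vector_mult_def vec_eq_iff sum.distrib algebra_simps scaleR_sum_right
        intro!: linearI)
    then show ?thesis by (rule linear_imp_has_derivative)
  qed
  show ?thesis
    unfolding fundamental_field_def[abs_def] ext2_def
    by (rule differentiableI, rule has_derivative_scaleR_right, rule has_derivative_sum,
        rule has_derivative_sum, rule has_derivative_scaleR_right,
        rule bounded_bilinear.FDERIV[OF bounded_bilinear_wedge2 d d])
qed

lemma vf_schouten_wedge2:
  assumes "X1 differentiable at x" "X2 differentiable at x"
    and "Y1 differentiable at x" "Y2 differentiable at x"
  shows "vf_schouten (\<lambda>y. wedge2 (X1 y) (X2 y)) (\<lambda>y. wedge2 (Y1 y) (Y2 y)) x =
           vf_schouten_decomposable X1 X2 Y1 Y2 x"
proof -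
  let ?D = "\<lambda>X. frechet_derivative X (at x)"
  note D = assms[unfolded frechet_derivative_works]
  define P' where "P' h = wedge2 (X1 x) (?D X2 h) + wedge2 (?D X1 h) (X2 x)" for h
  define Q' where "Q' h = wedge2 (Y1 x) (?D Y2 h) + wedge2 (?D Y1 h) (Y2 x)" for h
  have P: "((\<lambda>y. wedge2 (X1 y) (X2 y)) has_derivative P') (at x)"
    and Q: "((\<lambda>y. wedge2 (Y1 y) (Y2 y)) has_derivative Q') (at x)"
    unfolding P'_def Q'_def
    by (intro bounded_bilinear.FDERIV[OF bounded_bilinear_wedge2] D)+
  have c: "coeff2 (r + s) a b = coeff2 r a b + coeff2 s a b" for r s and a b :: 'a
    by (simp add: coeff2_def blinfun.add_left)
  define M where "M h b = wedge3 (Y1 x) b (?D Y2 h) + wedge3 (?D Y1 h) b (Y2 x)" for h b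
  define N where "N h d = wedge3 (X1 x) (?D X2 h) d + wedge3 (?D X1 h) (X2 x) d" for h d
  have lin: "linear (?D X1)" "linear (?D X2)" "linear (?D Y1)" "linear (?D Y2)"
    using D by (auto intro: has_derivative_linear)
  note l = linear_compose[OF _ wedge3_linear(1), unfolded o_def]
    linear_compose[OF _ wedge3_linear(2), unfolded o_def]
    linear_compose[OF _ wedge3_linear(3), unfolded o_def]
  have Mb: "bilinear M" and Nb: "bilinear N"
    unfolding M_def N_def bilinear_def
    by (intro conjI allI linear_compose_add wedge3_linear l lin)+
  have b1: "bilinear (\<lambda>c d. wedge3 c b d)" and b2: "bilinear (\<lambda>c d. wedge3 c d b)" for b :: 'a
    unfolding bilinear_def by (intro conjI allI wedge3_linear)+
  have M: "(\<Sum>c\<in>Basis. \<Sum>d\<in>Basis. coeff2 (Q' h) c d *\<^sub>R wedge3 c b d) = 2 *\<^sub>R M h b" for h b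
    unfolding Q'_def c scaleR_add_left sum.distrib sum_coeff2_wedge2[OF b1] M_def
    using wedge3_swap(3)[of "?D Y2 h" b "Y1 x"] wedge3_swap(3)[of "Y2 x" b "?D Y1 h"]
    by (simp add: scaleR_2)
  have N: "(\<Sum>a\<in>Basis. \<Sum>b\<in>Basis. coeff2 (P' h) a b *\<^sub>R wedge3 a b d) = 2 *\<^sub>R N h d" for h d
    unfolding P'_def c scaleR_add_left sum.distrib sum_coeff2_wedge2[OF b2] N_def
    using wedge3_swap(1)[of "?D X2 h" "X1 x" d] wedge3_swap(1)[of "X2 x" "?D X1 h" d]
    by (simp add: scaleR_2)
  let ?p = "coeff2 (wedge2 (X1 x) (X2 x))" and ?q = "coeff2 (wedge2 (Y1 x) (Y2 x))"
  have Mb': "bilinear (\<lambda>a b. M b a)" and Nb': "bilinear (\<lambda>a b. N b a)"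
    using Mb Nb by (auto simp: bilinear_def)
  have S1: "(\<Sum>a\<in>Basis. \<Sum>b\<in>Basis. \<Sum>c\<in>Basis. \<Sum>d\<in>Basis. (?p a b * coeff2 (Q' a) c d) *\<^sub>R wedge3 c b d)
      = 2 *\<^sub>R (M (X1 x) (X2 x) - M (X2 x) (X1 x))"
    by (simp flip: scaleR_scaleR scaleR_sum_right add: M)
      (simp add: scaleR_left_commute[of _ 2] scaleR_sum_right[symmetric] sum_coeff2_wedge2[OF Mb] del: scaleR_scaleR)
  have S4: "(\<Sum>a\<in>Basis. \<Sum>b\<in>Basis. \<Sum>c\<in>Basis. \<Sum>d\<in>Basis. (?p a b * coeff2 (Q' b) c d) *\<^sub>R wedge3 c a d)
      = 2 *\<^sub>R (M (X2 x) (X1 x) - M (X1 x) (X2 x))"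
    by (simp flip: scaleR_scaleR scaleR_sum_right add: M)
      (simp add: scaleR_left_commute[of _ 2] scaleR_sum_right[symmetric] sum_coeff2_wedge2[OF Mb'] del: scaleR_scaleR)
  have swap: "(\<Sum>a\<in>Basis. \<Sum>b\<in>Basis. \<Sum>c\<in>Basis. \<Sum>d\<in>Basis. F a b c d) =
      (\<Sum>c\<in>Basis. \<Sum>d\<in>Basis. \<Sum>a\<in>Basis. \<Sum>b\<in>Basis. F a b c d)"
    for F :: "'a \<Rightarrow> 'a \<Rightarrow> 'a \<Rightarrow> 'a \<Rightarrow> 'a tensor3"
  proof -
    have e: "(\<Sum>b\<in>Basis. \<Sum>c\<in>Basis. \<Sum>d\<in>Basis. G b c d) = (\<Sum>c\<in>Basis. \<Sum>d\<in>Basis. \<Sum>b\<in>Basis. G b c d)"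
      for G :: "'a \<Rightarrow> 'a \<Rightarrow> 'a \<Rightarrow> 'a tensor3"
      by (rule trans[OF sum.swap], rule sum.cong[OF refl], rule sum.swap)
    have "(\<Sum>a\<in>Basis. \<Sum>b\<in>Basis. \<Sum>c\<in>Basis. \<Sum>d\<in>Basis. F a b c d) =
        (\<Sum>a\<in>Basis. \<Sum>c\<in>Basis. \<Sum>d\<in>Basis. \<Sum>b\<in>Basis. F a b c d)"
      by (rule sum.cong[OF refl], rule e)
    also have "\<dots> = (\<Sum>c\<in>Basis. \<Sum>d\<in>Basis. \<Sum>a\<in>Basis. \<Sum>b\<in>Basis. F a b c d)"
      by (rule e)
    finally show ?thesis .
  qed
  have S2: "(\<Sum>a\<in>Basis. \<Sum>b\<in>Basis. \<Sum>c\<in>Basis. \<Sum>d\<in>Basis. (?q c d * coeff2 (P' c) a b) *\<^sub>R wedge3 a b d)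
      = 2 *\<^sub>R (N (Y1 x) (Y2 x) - N (Y2 x) (Y1 x))"
    by (rule trans[OF swap], simp flip: scaleR_scaleR scaleR_sum_right add: N)
      (simp add: scaleR_left_commute[of _ 2] scaleR_sum_right[symmetric] sum_coeff2_wedge2[OF Nb] del: scaleR_scaleR)
  have S3: "(\<Sum>a\<in>Basis. \<Sum>b\<in>Basis. \<Sum>c\<in>Basis. \<Sum>d\<in>Basis. (?q c d * coeff2 (P' d) a b) *\<^sub>R wedge3 a b c)
      = 2 *\<^sub>R (N (Y2 x) (Y1 x) - N (Y1 x) (Y2 x))"
    by (rule trans[OF swap], simp flip: scaleR_scaleR scaleR_sum_right add: N)
      (simp add: scaleR_left_commute[of _ 2] scaleR_sum_right[symmetric] sum_coeff2_wedge2[OF Nb'] del: scaleR_scaleR)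
  have "vf_schouten (\<lambda>y. wedge2 (X1 y) (X2 y)) (\<lambda>y. wedge2 (Y1 y) (Y2 y)) x =
      (1/4) *\<^sub>R (2 *\<^sub>R (M (X1 x) (X2 x) - M (X2 x) (X1 x)) - 2 *\<^sub>R (N (Y1 x) (Y2 x) - N (Y2 x) (Y1 x))
        + 2 *\<^sub>R (N (Y2 x) (Y1 x) - N (Y1 x) (Y2 x)) - 2 *\<^sub>R (M (X2 x) (X1 x) - M (X1 x) (X2 x)))"
    unfolding vf_schouten_has_derivative[OF P Q] sum.distrib sum_subtractf S1 S2 S3 S4 ..
  also have "\<dots> = (1/4) *\<^sub>R (4 *\<^sub>R (M (X1 x) (X2 x) - M (X2 x) (X1 x) - N (Y1 x) (Y2 x) + N (Y2 x) (Y1 x)))"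
    by (intro blinfun_eqI) (simp add: blinfun.diff_left blinfun.add_left blinfun.scaleR_left)
  also have "\<dots> = M (X1 x) (X2 x) - M (X2 x) (X1 x) - N (Y1 x) (Y2 x) + N (Y2 x) (Y1 x)"
    by simp
  also have "\<dots> = vf_schouten_decomposable X1 X2 Y1 Y2 x"
    unfolding M_def N_def vf_schouten_decomposable_def vf_bracket_def linear_diff[OF wedge3_linear(1)]
    by (intro blinfun_eqI)
      (simp add: wedge3_apply blinfun.diff_left blinfun.add_left algebra_simps)
  finally show ?thesis .
qed


section \<open>The Lie algebras\<close>

definition simple_lie_algebra :: "('a::real_normed_field^'n^'n) set \<Rightarrow> bool" where
  "simple_lie_algebra \<gg> \<longleftrightarrow>
     subspace \<gg> \<and> (\<forall>X\<in>\<gg>. \<forall>Y\<in>\<gg>. lie_bracket X Y \<in> \<gg>) \<and>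
     (\<exists>X\<in>\<gg>. \<exists>Y\<in>\<gg>. lie_bracket X Y \<noteq> 0) \<and>
     (\<forall>\<ii>. subspace \<ii> \<and> \<ii> \<subseteq> \<gg> \<and> (\<forall>X\<in>\<gg>. \<forall>Y\<in>\<ii>. lie_bracket X Y \<in> \<ii>) \<longrightarrow> \<ii> = {0} \<or> \<ii> = \<gg>)"

definition so_algebra :: "(real^'n^'n) set" where
  "so_algebra = {A. transpose A = - A}"

definition sl_algebra :: "(real^'n^'n) set" where
  "sl_algebra = {A. trace A = 0}"

text \<open>\<open>\<real>\<^sup>2\<^sup>n\<close> is indexed by the disjoint union of two copies of the index type.\<close>

definition symplectic_form :: "real^('n::finite + 'n) \<Rightarrow> real^('n + 'n) \<Rightarrow> real" where
  "symplectic_form x y = (\<Sum>i\<in>UNIV. x $ Inl i * y $ Inr i - x $ Inr i * y $ Inl i)"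

definition sp_algebra :: "(real^('n::finite + 'n)^('n + 'n)) set" where
  "sp_algebra = {A. \<forall>x y. symplectic_form (A *v x) y + symplectic_form x (A *v y) = 0}"

definition su_algebra :: "(complex^'n^'n) set" where
  "su_algebra = {A. (\<forall>i j. cnj (A $ j $ i) = - A $ i $ j) \<and> trace A = 0}"

end

theory Submission
  imports Defs
begin

text \<open>
  Linear vector fields satisfy \<open>[r\<^sub>M, r\<^sub>M] = - [r, r]\<^sub>M\<close>, so everything concerns the invariant trivector
  \<open>t = [r, r]\<close>, viewed as an alternating form on matrices via the trace inner product. In these terms
  \<open>t\<^sub>M(x)\<close> is \<open>G(u, v, w) = t(u x\<^sup>*, v x\<^sup>*, w x\<^sup>*)\<close>, and invariance under a matrix \<open>Z\<close> having \<open>x\<close> as an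
  eigenvector constrains \<open>G\<close>. For \<open>sl\<close> (up to scalar matrices, which act trivially) and \<open>sp\<close> there is
  such a symmetric \<open>Z\<close> of rank at most two with eigenvalue \<open>\<bar>x\<bar>\<^sup>2\<close>, and \<open>3 \<bar>x\<bar>\<^sup>2\<close> is not a weight of \<open>Z\<close>
  on trivectors. For \<open>so\<close> one has \<open>G(x, v, w) = 0\<close>, and rotations in planes orthogonal to \<open>x\<close> kill the
  remaining part in dimension at least five; there is no room for it in dimension at most three,
  and \<open>so(4)\<close> is not simple. For \<open>su\<close> the vanishing of \<open>G\<close> reduces \<open>t\<close> to its values on
  \<open>(i x x\<^sup>*, i y y\<^sup>*, i z z\<^sup>*)\<close> with \<open>x, y, z\<close> pairwise orthogonal, where invariance under
  \<open>i (y z\<^sup>* + z y\<^sup>*)\<close> forces \<open>t\<close> to vanish.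
\<close>

section \<open>Alternating trilinear forms\<close>

locale alternating3 =
  fixes T :: "'v::real_vector \<Rightarrow> 'v \<Rightarrow> 'v \<Rightarrow> real"
  assumes linear: "linear (\<lambda>a. T a b c)" "linear (\<lambda>b. T a b c)" "linear (\<lambda>c. T a b c)"
    and alt [simp]: "T a a b = 0" "T a b a = 0" "T b a a = 0"
begin

lemma add: "T (a + a') b c = T a b c + T a' b c" "T a (b + b') c = T a b c + T a b' c"
    "T a b (c + c') = T a b c + T a b c'"
  by (rule linear_add[OF linear(1)] linear_add[OF linear(2)] linear_add[OF linear(3)])+

lemma diff: "T (a - a') b c = T a b c - T a' b c" "T a (b - b') c = T a b c - T a b' c"
    "T a b (c - c') = T a b c - T a b c'"
  by (rule linear_diff[OF linear(1)] linear_diff[OF linear(2)] linear_diff[OF linear(3)])+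

lemma scaleR: "T (k *\<^sub>R a) b c = k * T a b c" "T a (k *\<^sub>R b) c = k * T a b c"
    "T a b (k *\<^sub>R c) = k * T a b c"
  using linear_cmul[OF linear(1)] linear_cmul[OF linear(2)] linear_cmul[OF linear(3)] by auto

lemma minus: "T (- a) b c = - T a b c" "T a (- b) c = - T a b c" "T a b (- c) = - T a b c"
  by (rule linear_neg[OF linear(1)] linear_neg[OF linear(2)] linear_neg[OF linear(3)])+

lemma zero [simp]: "T 0 b c = 0" "T a 0 c = 0" "T a b 0 = 0"
  by (rule linear_0[OF linear(1)] linear_0[OF linear(2)] linear_0[OF linear(3)])+

lemma swap: "T a b c = - T b a c" "T a b c = - T a c b"
  using alt(1)[of "a + b" c] alt(3)[of a "b + c"] by (simp_all add: add del: alt) (simp_all add: alt)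

lemma compose: "linear f \<Longrightarrow> alternating3 (\<lambda>a b c. T (f a) (f b) (f c))"
  by (rule alternating3.intro)
    (auto simp: linear_compose[OF _ linear(1), unfolded o_def]
      linear_compose[OF _ linear(2), unfolded o_def] linear_compose[OF _ linear(3), unfolded o_def])

end


section \<open>Coefficients of trivectors\<close>

text \<open>A \<open>tensor3\<close> is an arbitrary trilinear form. Membership here supplies
  alternation and confinement to \<open>V\<close>, both checked on generators through
  \<open>Wedge3_induct\<close>.\<close>

definition Wedge3 :: "'v::real_normed_vector set \<Rightarrow> 'v tensor3 set" where
  "Wedge3 V = span {wedge3 X Y Z | X Y Z. X \<in> V \<and> Y \<in> V \<and> Z \<in> V}"

lemma blinfun_inner_left_Riesz:
  fixes \<alpha> :: "'v::euclidean_space dual"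
  shows "blinfun_inner_left (\<Sum>b\<in>Basis. blinfun_apply \<alpha> b *\<^sub>R b) = \<alpha>"
  by (intro blinfun_euclidean_eqI) (simp add: inner_sum_left inner_sum_right inner_Basis if_distrib cong: if_cong)

text \<open>By Riesz every functional is the inner product with some vector, so
  \<open>coeff3\<close> at arbitrary vectors recovers the whole form.\<close>

lemma coeff3_eqI:
  assumes "\<And>u v w. coeff3 s u v w = coeff3 t u v w"
  shows "s = t"
proof (intro blinfun_eqI)
  fix \<alpha> \<beta> \<gamma> :: "'a dual"
  show "blinfun_apply (blinfun_apply (blinfun_apply s \<alpha>) \<beta>) \<gamma> =
      blinfun_apply (blinfun_apply (blinfun_apply t \<alpha>) \<beta>) \<gamma>"
    using assms[of "\<Sum>b\<in>Basis. blinfun_apply \<alpha> b *\<^sub>R b" "\<Sum>b\<in>Basis. blinfun_apply \<beta> b *\<^sub>R b"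
        "\<Sum>b\<in>Basis. blinfun_apply \<gamma> b *\<^sub>R b"]
    by (simp only: coeff3_def coeff2_def blinfun_inner_left_Riesz)
qed

lemma coeff3_linear: "linear (\<lambda>t. coeff3 t u v w)"
  by (auto simp: coeff3_def coeff2_def blinfun.add_left blinfun.scaleR_left intro!: linearI)

lemmas coeff3_simps = linear_add[OF coeff3_linear] linear_diff[OF coeff3_linear]
  linear_neg[OF coeff3_linear] linear_cmul[OF coeff3_linear] linear_0[OF coeff3_linear]

lemma coeff3_wedge3:
  "coeff3 (wedge3 X Y Z) u v w =
     X \<bullet> u * (Y \<bullet> v * (Z \<bullet> w) - Z \<bullet> v * (Y \<bullet> w))
   + Y \<bullet> u * (Z \<bullet> v * (X \<bullet> w) - X \<bullet> v * (Z \<bullet> w))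
   + Z \<bullet> u * (X \<bullet> v * (Y \<bullet> w) - Y \<bullet> v * (X \<bullet> w))"
  by (simp add: coeff3_def coeff2_def wedge3_apply algebra_simps)

lemma Wedge3_induct [consumes 1, case_names zero step]:
  assumes "t \<in> Wedge3 V" "P 0"
    and "\<And>k X Y Z t. X \<in> V \<Longrightarrow> Y \<in> V \<Longrightarrow> Z \<in> V \<Longrightarrow> P t \<Longrightarrow> P (k *\<^sub>R wedge3 X Y Z + t)"
  shows "P t"
  using assms(1) unfolding Wedge3_def
  by (induction rule: span_induct_alt) (use assms in auto)

lemma Wedge2_induct [consumes 1, case_names zero step]:
  assumes "r \<in> Wedge2 V" "P 0"
    and "\<And>k X Y r. X \<in> V \<Longrightarrow> Y \<in> V \<Longrightarrow> P r \<Longrightarrow> P (k *\<^sub>R wedge2 X Y + r)"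
  shows "P r"
  using assms(1) unfolding Wedge2_def
  by (induction rule: span_induct_alt) (use assms in auto)

lemma alternating3_coeff3:
  assumes "t \<in> Wedge3 V"
  shows "alternating3 (coeff3 t)"
proof (rule alternating3.intro)
  have i: "blinfun_inner_left (a + b) = blinfun_inner_left a + blinfun_inner_left b"
    "blinfun_inner_left (k *\<^sub>R a) = k *\<^sub>R blinfun_inner_left a" for a b :: 'a and k
    by (auto intro!: blinfun_eqI simp: inner_add_right blinfun.add_left blinfun.scaleR_left)
  show "linear (\<lambda>a. coeff3 t a b c)" "linear (\<lambda>b. coeff3 t a b c)" "linear (\<lambda>c. coeff3 t a b c)" for a b c
    by (auto simp: coeff3_def coeff2_def i blinfun.add_right blinfun.scaleR_right
        blinfun.add_left blinfun.scaleR_left intro!: linearI)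
  show "coeff3 t a a b = 0" "coeff3 t a b a = 0" "coeff3 t b a a = 0" for a b
    using assms by (induction rule: Wedge3_induct) (simp_all add: coeff3_simps coeff3_wedge3 algebra_simps)
qed

text \<open>This is how confinement to the algebra gets used: the matrices of \<open>so\<close> are
  orthogonal to \<open>outer x x\<close>, those of \<open>su\<close> to all Hermitian
  matrices.\<close>

lemma coeff3_orthogonal:
  assumes "t \<in> Wedge3 V" "\<And>X. X \<in> V \<Longrightarrow> X \<bullet> u = 0"
  shows "coeff3 t u v w = 0"
  using assms by (induction rule: Wedge3_induct) (auto simp: coeff3_simps coeff3_wedge3)

text \<open>The adjoints move the action of \<open>Z\<close> from the trivector to the test
  matrices, so that invariance becomes an identity for the form \<open>coeff3 t\<close>.\<close>

lemma coeff3_ad3: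
  assumes "t \<in> Wedge3 V"
  shows "coeff3 (ad3 Z t) u v w = coeff3 t (adjoint (lie_bracket Z) u) v w
    + coeff3 t u (adjoint (lie_bracket Z) v) w + coeff3 t u v (adjoint (lie_bracket Z) w)"
proof -
  have a: "linear (ad3 Z)" unfolding ad3_def by (rule ext3_linear)
  show ?thesis
    using assms
    by (induction rule: Wedge3_induct)
      (simp_all add: coeff3_simps linear_0[OF a] linear_add[OF a] linear_cmul[OF a] ad3_wedge3
        coeff3_wedge3 adjoint_works[OF lie_bracket_linear(2)] algebra_simps)
qed

lemma schouten_in_Wedge3:
  assumes r: "r \<in> Wedge2 V" and s: "s \<in> Wedge2 V"
    and closed: "\<And>X Y. X \<in> V \<Longrightarrow> Y \<in> V \<Longrightarrow> lie_bracket X Y \<in> V"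
  shows "schouten r s \<in> Wedge3 V"
proof -
  have sub: "subspace (Wedge3 V)" by (simp add: Wedge3_def)
  have w: "wedge3 X Y Z \<in> Wedge3 V" if "X \<in> V" "Y \<in> V" "Z \<in> V" for X Y Z
    using that unfolding Wedge3_def by (intro span_base) auto
  note b = bilinear_ladd[OF schouten_bilinear] bilinear_radd[OF schouten_bilinear]
    bilinear_lzero[OF schouten_bilinear] bilinear_rzero[OF schouten_bilinear]
    bilinear_lmul[OF schouten_bilinear] bilinear_rmul[OF schouten_bilinear]
  note s' = subspace_0[OF sub] subspace_add[OF sub] subspace_scale[OF sub] subspace_diff[OF sub]
  have 1: "schouten (wedge2 X Y) s \<in> Wedge3 V" if "X \<in> V" "Y \<in> V" for X Y
    using s that
    by (induction rule: Wedge2_induct)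
      (auto simp: b schouten_wedge2 schouten_decomposable_def intro!: s' w closed)
  show ?thesis
    using r by (induction rule: Wedge2_induct) (auto simp: b 1 intro!: s')
qed


section \<open>The Schouten bracket of fundamental bivector fields\<close>

lemma linear_matrix_vector_mult:
  "linear (\<lambda>A :: 'a::real_normed_field^'n^'m. A *v x)" "linear ((*v) (A :: 'a^'n^'m))"
  by (auto simp: matrix_vector_mult_def vec_eq_iff sum.distrib algebra_simps scaleR_sum_right
      intro!: linearI)

lemma frechet_derivative_matrix:
  "frechet_derivative ((*v) (A :: 'a::{real_normed_field,euclidean_space}^'n^'m)) (at x) = (*v) A"
  by (intro frechet_derivative_at[symmetric] linear_imp_has_derivative linear_matrix_vector_mult)

lemma vf_bracket_matrix:
  "vf_bracket ((*v) A) ((*v) B) x = - (lie_bracket A B *v x)"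
  for A B :: "'a::{real_normed_field,euclidean_space}^'n^'n"
  by (simp add: vf_bracket_def frechet_derivative_matrix lie_bracket_def
      matrix_vector_mul_assoc matrix_vector_mult_diff_rdistrib)

lemma fundamental_field_wedge2:
  "fundamental_field (wedge2 X Y) x = wedge2 (X *v x) (Y *v x)"
  using fundamental_field_sum[of "\<lambda>_. X" "\<lambda>_. Y" "{()}" x] by simp

lemma fundamental_field_linear: "linear (\<lambda>r. fundamental_field r x)"
  unfolding fundamental_field_def by (rule ext2_linear)

text \<open>The bracket of linear vector fields is minus the commutator of matrices, hence the sign.\<close>

lemma coeff3_vf_schouten:
  fixes r s :: "('a::{real_normed_field,euclidean_space}^'n^'n) tensor2"
  assumes r: "r \<in> Wedge2 V" and s: "s \<in> Wedge2 V"
  defines "p x \<equiv> adjoint (\<lambda>A :: 'a^'n^'n. A *v x)"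
  shows "coeff3 (vf_schouten (fundamental_field r) (fundamental_field s) x) u v w =
    - coeff3 (schouten r s) (p x u) (p x v) (p x w)"
proof -
  note F = linear_0[OF fundamental_field_linear] linear_add[OF fundamental_field_linear]
  note b = bilinear_ladd[OF schouten_bilinear] bilinear_radd[OF schouten_bilinear]
    bilinear_lzero[OF schouten_bilinear] bilinear_rzero[OF schouten_bilinear]
  have p: "A \<bullet> p x u = (A *v x) \<bullet> u" for A u
    unfolding p_def by (rule adjoint_works[OF linear_matrix_vector_mult(1)])
  have d: "(\<lambda>y. fundamental_field r y) differentiable at x" for r :: "('a^'n^'n) tensor2"
    by (rule fundamental_field_differentiable)
  have m: "((*v) A) differentiable at x" for A :: "'a^'n^'n"
    by (intro linear_imp_differentiable linear_matrix_vector_mult)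
  have W: "coeff3 (vf_schouten (fundamental_field (wedge2 X1 X2)) (fundamental_field (wedge2 Y1 Y2)) x) u v w =
    - coeff3 (schouten (wedge2 X1 X2) (wedge2 Y1 Y2)) (p x u) (p x v) (p x w)" for X1 X2 Y1 Y2
    unfolding fundamental_field_wedge2[abs_def] vf_schouten_wedge2[OF m m m m]
      vf_schouten_decomposable_def schouten_wedge2 schouten_decomposable_def
    by (simp add: coeff3_simps coeff3_wedge3 p vf_bracket_matrix algebra_simps)
  \<comment> \<open>Scalars are absorbed into the first factor and zero is written as a
    decomposable, so the two inductions need only \<open>W\<close> and additivity of
    \<open>vf_schouten\<close>.\<close>
  have sc: "k *\<^sub>R wedge2 X Y = wedge2 (k *\<^sub>R X) Y" for k and X Y :: "'a^'n^'n"
    by (simp add: bilinear_lmul[OF bilinear_wedge2])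
  have z: "0 = wedge2 0 (0 :: 'a^'n^'n)"
    by simp
  have 1: "coeff3 (vf_schouten (fundamental_field (wedge2 X Y)) (fundamental_field s) x) u v w =
    - coeff3 (schouten (wedge2 X Y) s) (p x u) (p x v) (p x w)" for X Y
    using s
  proof (induction rule: Wedge2_induct)
    case zero
    show ?case by (subst (1 2) z) (rule W)
  next
    case (step k X' Y' s)
    then show ?case
      unfolding sc F(2)[abs_def] vf_schouten_add(2)[OF d d d]
      by (simp add: W b coeff3_simps)
  qed
  show ?thesis
    using r
  proof (induction rule: Wedge2_induct)
    case zero
    show ?case by (subst (1 2) z) (rule 1)
  next
    case (step k X' Y' r)
    then show ?case
      unfolding sc F(2)[abs_def] vf_schouten_add(1)[OF d d d]
      by (simp add: 1 b coeff3_simps)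
  qed
qed

lemma poisson_fundamental_field_iff:
  fixes r :: "('a::{real_normed_field,euclidean_space}^'n^'n) tensor2"
  assumes "r \<in> Wedge2 V"
  shows "poisson (fundamental_field r) \<longleftrightarrow>
    (\<forall>x u v w. coeff3 (schouten r r) (adjoint (\<lambda>A. A *v x) u) (adjoint (\<lambda>A. A *v x) v)
      (adjoint (\<lambda>A. A *v x) w) = 0)"
proof -
  have "(\<forall>u v w. coeff3 t u v w = 0) \<longleftrightarrow> t = 0" for t :: "('a^'n) tensor3"
    using coeff3_eqI[of t 0] by (auto simp: coeff3_simps)
  then show ?thesis
    unfolding poisson_def by (metis coeff3_vf_schouten[OF assms assms] neg_equal_0_iff_equal)
qed

lemma schouten_classical_r_matrix:
  assumes "simple_lie_algebra \<gg>" "classical_r_matrix \<gg> r"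
  shows "schouten r r \<in> Wedge3 \<gg>"
  using assms unfolding simple_lie_algebra_def classical_r_matrix_def
  by (intro schouten_in_Wedge3) auto


section \<open>Real matrix algebras\<close>

definition outer :: "real^'n \<Rightarrow> real^'m \<Rightarrow> real^'m^'n" where
  "outer u x = (\<chi> i j. u $ i * x $ j)"

lemma outer_linear: "linear (\<lambda>u. outer u x)" "linear (outer u)"
  by (auto simp: outer_def vec_eq_iff algebra_simps intro!: linearI)

lemma outer_mult_vector: "outer u x *v y = (x \<bullet> y) *\<^sub>R u"
  by (simp add: outer_def matrix_vector_mult_def inner_vec_def vec_eq_iff sum_distrib_left mult_ac)

lemma linear_transpose: "linear (transpose :: real^'n^'m \<Rightarrow> _)"
  by (auto simp: transpose_def vec_eq_iff intro!: linearI)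

lemma transpose_outer: "transpose (outer u x) = outer x u"
  by (simp add: outer_def transpose_def vec_eq_iff mult.commute)

lemma inner_outer: "A \<bullet> outer u x = (A *v x) \<bullet> u"
  by (simp add: outer_def inner_vec_def matrix_vector_mult_def sum_distrib_left mult_ac)

text \<open>Dualizing evaluation at \<open>x\<close> turns the Poisson condition into the vanishing
  of the trivector on rank-one matrices sharing the right factor \<open>x\<close>.\<close>

lemma adjoint_apply_vector: "adjoint (\<lambda>A. A *v x) = (\<lambda>u. outer u x)"
  by (intro adjoint_unique) (simp add: inner_outer)

lemma inner_matrix_mult:
  fixes X Y Z :: "real^'n^'n"
  shows "(Z ** X) \<bullet> Y = X \<bullet> (transpose Z ** Y)" "(X ** Z) \<bullet> Y = X \<bullet> (Y ** transpose Z)"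
proof -
  have "(Z ** X) \<bullet> Y = (\<Sum>i\<in>UNIV. \<Sum>j\<in>UNIV. \<Sum>k\<in>UNIV. Z $ i $ k * X $ k $ j * Y $ i $ j)"
    by (simp add: inner_vec_def matrix_matrix_mult_def sum_distrib_right)
  also have "\<dots> = (\<Sum>k\<in>UNIV. \<Sum>j\<in>UNIV. \<Sum>i\<in>UNIV. Z $ i $ k * X $ k $ j * Y $ i $ j)"
    by (subst (2) sum.swap, subst sum.swap, rule sum.cong[OF refl], rule sum.swap)
  also have "\<dots> = X \<bullet> (transpose Z ** Y)"
    by (simp add: inner_vec_def matrix_matrix_mult_def transpose_def sum_distrib_left mult_ac)
  finally show "(Z ** X) \<bullet> Y = X \<bullet> (transpose Z ** Y)" .
  have "(X ** Z) \<bullet> Y = (\<Sum>i\<in>UNIV. \<Sum>j\<in>UNIV. \<Sum>k\<in>UNIV. X $ i $ k * Z $ k $ j * Y $ i $ j)"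
    by (simp add: inner_vec_def matrix_matrix_mult_def sum_distrib_right)
  also have "\<dots> = (\<Sum>i\<in>UNIV. \<Sum>k\<in>UNIV. \<Sum>j\<in>UNIV. X $ i $ k * Z $ k $ j * Y $ i $ j)"
    by (rule sum.cong[OF refl], rule sum.swap)
  also have "\<dots> = X \<bullet> (Y ** transpose Z)"
    by (simp add: inner_vec_def matrix_matrix_mult_def transpose_def sum_distrib_left mult_ac)
  finally show "(X ** Z) \<bullet> Y = X \<bullet> (Y ** transpose Z)" .
qed

lemma adjoint_lie_bracket: "adjoint (lie_bracket Z) = lie_bracket (transpose Z)"
  for Z :: "real^'n^'n"
  by (intro adjoint_unique)
    (simp add: lie_bracket_def inner_diff_left inner_diff_right
      inner_matrix_mult(1)[of Z] inner_matrix_mult(2)[of _ Z])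

lemma matrix_mult_outer:
  fixes Z :: "real^'n^'n"
  shows "Z ** outer u x = outer (Z *v u) x" "outer u x ** transpose Z = outer u (Z *v x)"
  by (simp_all add: outer_def matrix_matrix_mult_def matrix_vector_mult_def transpose_def
      vec_eq_iff sum_distrib_left sum_distrib_right mult_ac)

lemma poisson_real_iff:
  fixes r :: "(real^'n^'n) tensor2"
  assumes "r \<in> Wedge2 V"
  shows "poisson (fundamental_field r) \<longleftrightarrow>
    (\<forall>x u v w. coeff3 (schouten r r) (outer u x) (outer v x) (outer w x) = 0)"
  unfolding poisson_fundamental_field_iff[OF assms] adjoint_apply_vector ..

lemma alternating3_outer:
  "t \<in> Wedge3 V \<Longrightarrow> alternating3 (\<lambda>u v w. coeff3 t (outer u x) (outer v x) (outer w x))"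
  by (rule alternating3.compose[OF alternating3_coeff3 outer_linear(1)])

text \<open>The bracket of Z^T with u x^T is (Z^T u) x^T - u (Z x)^T, and the second term is c u
  x^T. The three slots together contribute 3 c.\<close>

lemma coeff3_outer_invariant:
  fixes t :: "(real^'n^'n) tensor3"
  assumes t: "t \<in> Wedge3 V" and inv: "ad3 Z t = 0" and x: "Z *v x = c *\<^sub>R x"
  defines "G u v w \<equiv> coeff3 t (outer u x) (outer v x) (outer w x)"
  shows "G (transpose Z *v u) v w + G u (transpose Z *v v) w + G u v (transpose Z *v w) = 3 * c * G u v w"
proof -
  interpret alternating3 "coeff3 t" using t by (rule alternating3_coeff3)
  have 1: "lie_bracket (transpose Z) (outer u x) = outer (transpose Z *v u) x - c *\<^sub>R outer u x" for u
    using matrix_mult_outer(2)[of u x Z]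
    by (simp add: lie_bracket_def matrix_mult_outer(1) x linear_cmul[OF outer_linear(2)])
  show ?thesis
    using coeff3_ad3[OF t, of Z "outer u x" "outer v x" "outer w x"]
    by (simp add: inv coeff3_simps adjoint_lie_bracket 1 diff scaleR G_def algebra_simps)
qed

text \<open>
  The weights of \<open>u \<mapsto> (x \<bullet> u) x - (y \<bullet> u) y\<close> are \<open>\<bar>x\<bar>\<^sup>2\<close>, \<open>- \<bar>y\<bar>\<^sup>2\<close> (both simple) and \<open>0\<close>, so that
  \<open>3 \<bar>x\<bar>\<^sup>2\<close> is not a weight of the third exterior power.
\<close>

lemma zero_if_weight:
  fixes x y :: "'v::real_inner"
  assumes "alternating3 T" and x: "x \<noteq> 0" and xy: "x \<bullet> y = 0"
  defines "Z u \<equiv> (x \<bullet> u) *\<^sub>R x - (y \<bullet> u) *\<^sub>R y"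
  assumes inv: "\<And>u v w. T (Z u) v w + T u (Z v) w + T u v (Z w) = 3 * (x \<bullet> x) * T u v w"
  shows "T u v w = 0"
proof -
  interpret alternating3 T by fact
  have pos: "x \<bullet> x > 0" "y \<bullet> y \<ge> 0"
    using x by simp_all
  have yx: "y \<bullet> x = 0" using xy by (simp add: inner_commute)
  note e = inv[unfolded Z_def diff scaleR]
  \<comment> \<open>\<open>x\<close> and \<open>y\<close> are eigenvectors with eigenvalues |x|^2
    and -|y|^2, while \<open>Z w\<close> lies in their span and drops out. Hence (|x|^2 - |y|^2) T =
    3 |x|^2 T. The next steps free one argument at a time in the same way.\<close>
  have "(2 * (x \<bullet> x) + y \<bullet> y) * T x y w = 0" for w
    using e[of x y w] by (simp add: xy yx algebra_simps)
  then have 1: "T x y w = 0" for w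
    using pos by (metis add_pos_nonneg mult_eq_0_iff mult_pos_pos less_irrefl zero_less_numeral)
  then have b1: "T x w y = 0" "T y x w = 0" "T y w x = 0" for w
    by (metis swap minus_zero)+
  have 2: "T x v w = 0" for v w
    using e[of x v w] pos by (simp add: xy yx 1 b1)
  then have b2: "T v x w = 0" "T v w x = 0" for v w
    by (metis swap minus_zero)+
  have "(3 * (x \<bullet> x) + y \<bullet> y) * T y v w = 0" for v w
    using e[of y v w] by (simp add: xy yx 1 b1 2 b2 algebra_simps)
  then have 3: "T y v w = 0" for v w
    using pos by (metis add_pos_nonneg mult_eq_0_iff mult_pos_pos less_irrefl zero_less_numeral)
  then have b3: "T v y w = 0" "T v w y = 0" for v w
    by (metis swap minus_zero)+
  show ?thesis
    using e[of u v w] pos by (simp add: 2 b2 3 b3)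
qed

section \<open>The special linear algebra\<close>

lemma poisson_sl:
  fixes r :: "(real^'n^'n) tensor2"
  assumes s: "simple_lie_algebra (sl_algebra :: (real^'n^'n) set)"
    and r: "classical_r_matrix sl_algebra r"
  shows "poisson (fundamental_field r)"
proof -
  have w: "r \<in> Wedge2 sl_algebra" using r by (simp add: classical_r_matrix_def)
  note t = schouten_classical_r_matrix[OF s r]
  show ?thesis
    unfolding poisson_real_iff[OF w]
  proof (intro allI)
    fix x u v w :: "real^'n"
    let ?G = "\<lambda>u v w. coeff3 (schouten r r) (outer u x) (outer v x) (outer w x)"
    interpret G: alternating3 ?G using t by (rule alternating3_outer)
    \<comment> \<open>This multiple of the identity makes \<open>Z\<close> traceless. It contributes
      -3 c to both sides of the invariance identity, leaving \<open>zero_if_weight\<close> with y =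
      0.\<close>
    define c where "c = (x \<bullet> x) / CARD('n)"
    define Z where "Z = outer x x - c *\<^sub>R mat 1"
    have "trace Z = 0"
      by (simp add: Z_def c_def trace_def outer_def mat_def sum_subtractf inner_vec_def)
    then have i: "ad3 Z (schouten r r) = 0"
      using r by (auto simp: classical_r_matrix_def sl_algebra_def)
    have Zv: "Z *v u = (x \<bullet> u) *\<^sub>R x - c *\<^sub>R u" for u
      by (simp add: Z_def matrix_vector_mult_diff_rdistrib outer_mult_vector scaleR_matrix_vector_assoc[symmetric])
    have tZ: "transpose Z = Z"
      by (simp add: Z_def outer_def mat_def transpose_def vec_eq_iff mult.commute)
    have "Z *v x = (x \<bullet> x - c) *\<^sub>R x"
      by (simp add: Zv algebra_simps)
    from coeff3_outer_invariant[OF t i this]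
    have "?G ((x \<bullet> u) *\<^sub>R x) v w + ?G u ((x \<bullet> v) *\<^sub>R x) w + ?G u v ((x \<bullet> w) *\<^sub>R x) = 3 * (x \<bullet> x) * ?G u v w" for u v w
      unfolding tZ Zv by (simp add: G.diff G.scaleR algebra_simps)
    then show "?G u v w = 0"
      using zero_if_weight[OF G.alternating3_axioms, of x 0 u v w]
      by (cases "x = 0") (auto simp: linear_0[OF outer_linear(2)] coeff3_def)
  qed
qed

section \<open>The symplectic algebra\<close>

text \<open>The complex structure J compatible with the symplectic form: an isometry with J^2 = -1
  that sends each vector to an orthogonal one.\<close>

definition symp :: "real^('n::finite + 'n) \<Rightarrow> real^('n + 'n)" where
  "symp x = (\<chi> i. case i of Inl k \<Rightarrow> x $ Inr k | Inr k \<Rightarrow> - x $ Inl k)"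

lemma inner_sum_index:
  "x \<bullet> y = (\<Sum>i\<in>UNIV. x $ Inl i * y $ Inl i) + (\<Sum>i\<in>UNIV. x $ Inr i * y $ Inr i)"
  for x y :: "real^('m::finite + 'n::finite)"
  by (simp add: inner_vec_def UNIV_Plus_UNIV[symmetric] sum.Plus del: UNIV_Plus_UNIV)

lemma symplectic_form_symp: "symplectic_form x y = x \<bullet> symp y"
  by (simp add: symplectic_form_def inner_sum_index symp_def sum_subtractf sum_negf)

lemma symp_linear: "linear symp"
  by (auto simp: symp_def vec_eq_iff split: sum.split intro!: linearI)

lemma symp_symp: "symp (symp x) = - x"
  by (simp add: symp_def vec_eq_iff split: sum.split)

lemma inner_symp: "symp x \<bullet> y = - (x \<bullet> symp y)" "symp x \<bullet> symp y = x \<bullet> y" "x \<bullet> symp x = 0"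
  by (simp_all add: inner_sum_index symp_def sum_negf mult.commute)

lemma inner_symp_skew: "x \<bullet> symp y = - (y \<bullet> symp x)"
  by (metis inner_commute inner_symp(1))

lemma poisson_sp:
  fixes r :: "(real^('n::finite + 'n)^('n + 'n)) tensor2"
  assumes s: "simple_lie_algebra (sp_algebra :: (real^('n + 'n)^('n + 'n)) set)"
    and r: "classical_r_matrix sp_algebra r"
  shows "poisson (fundamental_field r)"
proof -
  have w: "r \<in> Wedge2 sp_algebra" using r by (simp add: classical_r_matrix_def)
  note t = schouten_classical_r_matrix[OF s r]
  show ?thesis
    unfolding poisson_real_iff[OF w]
  proof (intro allI)
    fix x u v w :: "real^('n + 'n)"
    let ?G = "\<lambda>u v w. coeff3 (schouten r r) (outer u x) (outer v x) (outer w x)"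
    interpret G: alternating3 ?G using t by (rule alternating3_outer)
    define y where "y = symp x"
    \<comment> \<open>Conjugation by J exchanges the two rank-one terms, so \<open>Z\<close>
      anticommutes with J; being symmetric, it lies in \<open>sp_algebra\<close>.\<close>
    define Z where "Z = outer x x - outer y y"
    have Zv: "Z *v u = (x \<bullet> u) *\<^sub>R x - (y \<bullet> u) *\<^sub>R y" for u
      by (simp add: Z_def matrix_vector_mult_diff_rdistrib outer_mult_vector)
    have xy: "x \<bullet> y = 0" by (simp add: y_def inner_symp)
    have "Z \<in> sp_algebra"
      by (simp add: sp_algebra_def symplectic_form_symp Zv y_def linear_diff[OF symp_linear]
          linear_cmul[OF symp_linear] linear_add[OF symp_linear] inner_symp symp_symp
          inner_diff_left inner_diff_right inner_add_left inner_add_right)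
        (auto simp: inner_symp_skew[of _ x] inner_commute)
    then have i: "ad3 Z (schouten r r) = 0"
      using r by (auto simp: classical_r_matrix_def)
    have tZ: "transpose Z = Z"
      by (simp add: Z_def outer_def transpose_def vec_eq_iff mult.commute)
    have "Z *v x = (x \<bullet> x) *\<^sub>R x"
      using xy by (simp add: Zv inner_commute)
    from coeff3_outer_invariant[OF t i this]
    show "?G u v w = 0"
      using zero_if_weight[OF G.alternating3_axioms _ xy, of u v w]
      by (cases "x = 0") (auto simp: linear_0[OF outer_linear(2)] coeff3_def tZ Zv)
  qed
qed

section \<open>The orthogonal algebra\<close>

text \<open>Dimension four has to be excluded: there the contraction of the volume form with
  \<open>x\<close> satisfies all the other hypotheses.\<close>

lemma zero_if_stabilizer_so:
  fixes x :: "'v::euclidean_space"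
  assumes "alternating3 T" and x: "x \<noteq> 0" and Tx: "\<And>v w. T x v w = 0" and dim: "DIM('v) \<noteq> 4"
  defines "Z a b u \<equiv> (a \<bullet> u) *\<^sub>R b - (b \<bullet> u) *\<^sub>R a"
  assumes inv: "\<And>a b u v w. a \<bullet> x = 0 \<Longrightarrow> b \<bullet> x = 0 \<Longrightarrow>
    T (Z a b u) v w + T u (Z a b v) w + T u v (Z a b w) = 0"
  shows "T u v w = 0"
proof (cases "DIM('v) > 4")
  interpret alternating3 T by fact
  case True
  have orth: "T b v w = 0" if b: "b \<bullet> x = 0" for b v w
  proof -
    have "card {x, b, v, w} \<le> 4"
      using card_length[of "[x, b, v, w]"] by simp
    moreover have "dim {x, b, v, w} \<le> card {x, b, v, w}"
      by (intro dim_le_card') simp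
    ultimately have "dim {x, b, v, w} < DIM('v)"
      using True by simp
    then obtain a where a: "a \<noteq> 0" "\<And>y. y \<in> {x, b, v, w} \<Longrightarrow> a \<bullet> y = 0"
      by (metis orthogonal_to_subspace_exists orthogonal_def span_base)
    \<comment> \<open>\<open>Z a b\<close> sends \<open>a\<close> to |a|^2 b, and \<open>v\<close>,
      \<open>w\<close> to multiples of \<open>a\<close>, which alternation kills against the
      \<open>a\<close> in the first slot.\<close>
    have "(a \<bullet> a) * T b v w = 0"
      using inv[of a b a v w] a(2) b by (simp add: Z_def diff scaleR inner_commute[of b a] minus)
    then show ?thesis using a(1) by simp
  qed
  define k where "k = (u \<bullet> x) / (x \<bullet> x)"
  have "(u - k *\<^sub>R x) \<bullet> x = 0"
    using x by (simp add: k_def inner_diff_left)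
  then have "T (u - k *\<^sub>R x) v w = 0"
    by (rule orth)
  then show ?thesis
    by (simp add: diff scaleR Tx)
next
  interpret alternating3 T by fact
  case False
  show ?thesis
  proof (rule ccontr)
    assume T: "T u v w \<noteq> 0"
    have Tx': "T a x c = 0" "T a b x = 0" for a b c
      using swap(1)[of a x c] swap(2)[of a b x] swap(1)[of a x b] by (simp_all add: Tx)
    \<comment> \<open>A nonzero value would make \<open>x\<close>, \<open>w\<close>,
      \<open>v\<close>, \<open>u\<close> independent: each new vector avoids the span of the earlier
      ones, since \<open>T\<close> vanishes there. Dimension at most three has no room for four of
      them.\<close>
    have "T u v a = 0" if "a \<in> span {x}" for a
      by (rule linear_eq_0_on_span[OF linear(3) _ that]) (auto simp: Tx')
    then have "w \<notin> span {x}"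
      using T by blast
    moreover have "T u a w = 0" if "a \<in> span {w, x}" for a
      by (rule linear_eq_0_on_span[OF linear(2) _ that]) (auto simp: Tx')
    then have "v \<notin> span {w, x}"
      using T by blast
    moreover have "T a v w = 0" if "a \<in> span {v, w, x}" for a
      by (rule linear_eq_0_on_span[OF linear(1) _ that]) (auto simp: Tx)
    then have "u \<notin> span {v, w, x}"
      using T by blast
    ultimately have "independent {u, v, w, x}" "card {u, v, w, x} = 4"
      using x by (simp_all add: independent_insert span_base card_insert_if)
        (auto simp: span_base)
    then show False
      using independent_bound[of "{u, v, w, x}"] False dim by simp
  qed
qed

text \<open>The self-dual matrices are an ideal of \<open>so(4)\<close>.\<close>

lemma not_simple_so_4:
  assumes "CARD('n::finite) = 4"
  shows "\<not> simple_lie_algebra (so_algebra :: (real^'n^'n) set)"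
proof
  assume s: "simple_lie_algebra (so_algebra :: (real^'n^'n) set)"
  obtain i j k l :: 'n where U: "UNIV = {i, j, k, l}"
    and d: "i \<noteq> j" "i \<noteq> k" "i \<noteq> l" "j \<noteq> k" "j \<noteq> l" "k \<noteq> l"
    using assms by (auto simp: card_Suc_eq numeral_eq_Suc)
  have so: "A \<in> so_algebra \<longleftrightarrow> (\<forall>p q. A $ q $ p = - A $ p $ q)" for A :: "real^'n^'n"
    unfolding so_algebra_def transpose_def vec_eq_iff by simp
  \<comment> \<open>With the indices ordered i, j, k, l these are the equations A = *A for the Hodge
    star.\<close>
  define I where "I = {A \<in> so_algebra :: (real^'n^'n) set.
    A $ i $ j = A $ k $ l \<and> A $ i $ k = - A $ j $ l \<and> A $ i $ l = A $ j $ k}"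
  have sub: "subspace (so_algebra :: (real^'n^'n) set)"
    using s by (simp add: simple_lie_algebra_def)
  have "subspace I"
    unfolding I_def using subspace_0[OF sub] subspace_add[OF sub] subspace_scale[OF sub]
    by (intro subspaceI) simp_all
  moreover have "lie_bracket X Y \<in> I" if X: "X \<in> so_algebra" and Y: "Y \<in> I" for X Y
  proof -
    have skew: "A $ p $ p = 0" "A $ j $ i = - A $ i $ j" "A $ k $ i = - A $ i $ k"
      "A $ l $ i = - A $ i $ l" "A $ k $ j = - A $ j $ k" "A $ l $ j = - A $ j $ l"
      "A $ l $ k = - A $ k $ l" if A: "A \<in> so_algebra" for A :: "real^'n^'n" and p
    proof -
      show "A $ p $ p = 0"
        using A[unfolded so, THEN spec, THEN spec, of p p] by simp
    qed (rule A[unfolded so, rule_format])+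
    have Y': "Y \<in> so_algebra" "Y $ k $ l = Y $ i $ j" "Y $ j $ l = - Y $ i $ k" "Y $ j $ k = Y $ i $ l"
      using Y by (auto simp: I_def)
    have "lie_bracket X Y \<in> so_algebra"
      using s X Y'(1) by (simp add: simple_lie_algebra_def)
    moreover have "lie_bracket X Y $ p $ q = (X $ p $ i * Y $ i $ q - Y $ p $ i * X $ i $ q)
        + (X $ p $ j * Y $ j $ q - Y $ p $ j * X $ j $ q) + (X $ p $ k * Y $ k $ q - Y $ p $ k * X $ k $ q)
        + (X $ p $ l * Y $ l $ q - Y $ p $ l * X $ l $ q)" for p q
      using d by (simp add: lie_bracket_def matrix_matrix_mult_def U)
    ultimately show ?thesis
      by (simp add: I_def skew[OF X] skew[OF Y'(1)] Y'(2-))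
  qed
  moreover have "I \<subseteq> so_algebra"
    by (auto simp: I_def)
  ultimately have I: "I = {0} \<or> I = so_algebra"
    using s unfolding simple_lie_algebra_def by blast
  define B where "B p q = outer (axis p 1) (axis q 1) - outer (axis q 1) (axis p 1 :: real^'n)" for p q :: 'n
  have B: "B p q \<in> so_algebra" for p q
    by (simp add: so B_def outer_def mult.commute)
  \<comment> \<open>This self-dual matrix shows that the ideal is nonzero; \<open>B i j\<close>
    alone is not self-dual, so the ideal is proper.\<close>
  have "B i j + B k l \<in> I"
    using d subspace_add[OF sub B[of i j] B[of k l]] by (simp add: I_def) (simp add: B_def outer_def axis_def)
  moreover have "(B i j + B k l) $ i $ j = 1"
    using d by (simp add: B_def outer_def axis_def)
  ultimately have "I \<noteq> {0}"
    by (metis singletonD zero_index zero_neq_one)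
  moreover have "B i j $ k $ l \<noteq> B i j $ i $ j"
    using d by (simp add: B_def outer_def axis_def)
  then have "B i j \<notin> I"
    by (auto simp: I_def)
  ultimately show False
    using I B by auto
qed

lemma poisson_so:
  fixes r :: "(real^'n^'n) tensor2"
  assumes s: "simple_lie_algebra (so_algebra :: (real^'n^'n) set)"
    and r: "classical_r_matrix so_algebra r"
  shows "poisson (fundamental_field r)"
proof -
  have w: "r \<in> Wedge2 so_algebra" using r by (simp add: classical_r_matrix_def)
  note t = schouten_classical_r_matrix[OF s r]
  show ?thesis
    unfolding poisson_real_iff[OF w]
  proof (intro allI)
    fix x u v w :: "real^'n"
    let ?G = "\<lambda>u v w. coeff3 (schouten r r) (outer u x) (outer v x) (outer w x)"
    interpret G: alternating3 ?G using t by (rule alternating3_outer)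
    \<comment> \<open>This inner product is the quadratic form of a skew matrix at
      \<open>x\<close>.\<close>
    have "X \<bullet> outer x x = 0" if "X \<in> so_algebra" for X
    proof -
      have "(X *v x) \<bullet> x = (transpose X *v x) \<bullet> x"
        by (metis dot_lmul_matrix inner_commute vector_transpose_matrix)
      also have "\<dots> = - ((X *v x) \<bullet> x)"
        using that by (simp add: so_algebra_def linear_neg[OF linear_matrix_vector_mult(1)])
      finally show ?thesis by (simp add: inner_outer)
    qed
    then have x0: "?G x v w = 0" for v w
      by (rule coeff3_orthogonal[OF t])
    have inv: "?G ((a \<bullet> u) *\<^sub>R b - (b \<bullet> u) *\<^sub>R a) v w + ?G u ((a \<bullet> v) *\<^sub>R b - (b \<bullet> v) *\<^sub>R a) w
        + ?G u v ((a \<bullet> w) *\<^sub>R b - (b \<bullet> w) *\<^sub>R a) = 0"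
      if "a \<bullet> x = 0" "b \<bullet> x = 0" for a b u v w
    proof -
      \<comment> \<open>An infinitesimal rotation in the plane of \<open>a\<close> and
        \<open>b\<close>; it kills \<open>x\<close>, so the eigenvalue is 0.\<close>
      define Z where "Z = outer a b - outer b a"
      have Zv: "Z *v u = (b \<bullet> u) *\<^sub>R a - (a \<bullet> u) *\<^sub>R b"
        and tZ: "transpose Z *v u = (a \<bullet> u) *\<^sub>R b - (b \<bullet> u) *\<^sub>R a" for u
        by (simp_all add: Z_def matrix_vector_mult_diff_rdistrib outer_mult_vector
            linear_diff[OF linear_transpose] transpose_outer)
      have "Z \<in> so_algebra"
        by (simp add: Z_def so_algebra_def linear_diff[OF linear_transpose] transpose_outer)
      then have i: "ad3 Z (schouten r r) = 0"
        using r by (auto simp: classical_r_matrix_def)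
      have "Z *v x = 0 *\<^sub>R x"
        using that by (simp add: Zv)
      from coeff3_outer_invariant[OF t i this] show ?thesis
        unfolding tZ by simp
    qed
    have "DIM(real^'n) \<noteq> 4"
      using not_simple_so_4 s by auto
    with inv x0 show "?G u v w = 0"
      using zero_if_stabilizer_so[OF G.alternating3_axioms, of x u v w]
      by (cases "x = 0") (auto simp: linear_0[OF outer_linear(2)] coeff3_def)
  qed
qed

section \<open>Unitary matrix algebras\<close>

definition hadjoint :: "complex^'n^'m \<Rightarrow> complex^'m^'n" where
  "hadjoint A = (\<chi> i j. cnj (A $ j $ i))"

definition houter :: "complex^'n \<Rightarrow> complex^'m \<Rightarrow> complex^'m^'n" where
  "houter u x = (\<chi> i j. u $ i * cnj (x $ j))"

definition hinner :: "complex^'n \<Rightarrow> complex^'n \<Rightarrow> complex" where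
  "hinner x y = (\<Sum>i\<in>UNIV. cnj (x $ i) * y $ i)"

lemma su_algebra_iff: "A \<in> su_algebra \<longleftrightarrow> hadjoint A = - A \<and> trace A = 0"
  by (simp add: su_algebra_def hadjoint_def vec_eq_iff)

lemma inner_complex: "a \<bullet> b = Re (cnj a * b)"
  by (simp add: inner_complex_def)

lemma hadjoint_simps:
  "hadjoint (A + B) = hadjoint A + hadjoint B" "hadjoint (A - B) = hadjoint A - hadjoint B"
  "hadjoint (- A) = - hadjoint A" "hadjoint (hadjoint A) = A" "hadjoint (houter u x) = houter x u"
  by (simp_all add: hadjoint_def houter_def vec_eq_iff mult.commute)

lemma houter_simps:
  "houter (u + v) x = houter u x + houter v x" "houter (u - v) x = houter u x - houter v x"
  "houter (- u) x = - houter u x" "houter (k *\<^sub>R u) x = k *\<^sub>R houter u x" "houter 0 x = 0"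
  "houter u (x + y) = houter u x + houter u y" "houter u (c *s x) = houter (cnj c *s u) x" "houter u 0 = 0"
  by (simp_all add: houter_def vec_eq_iff algebra_simps)

lemma hinner_simps:
  "hinner x (y + z) = hinner x y + hinner x z" "hinner x (y - z) = hinner x y - hinner x z"
  "hinner x (c *s y) = c * hinner x y"
  by (simp_all add: hinner_def sum.distrib sum_subtractf sum_distrib_left algebra_simps)

lemma hinner_commute: "hinner y x = cnj (hinner x y)"
  by (simp add: hinner_def mult.commute)

lemma hinner_self: "hinner x x = complex_of_real (x \<bullet> x)"
  by (simp add: hinner_def inner_vec_def inner_complex_def complex_eq_iff power2_eq_square)

lemma orthogonal_decomposition:
  assumes "x \<noteq> 0"
  obtains c y' where "y = c *s x + y'" "hinner x y' = 0"
proof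
  show "y = (hinner x y / hinner x x) *s x + (y - (hinner x y / hinner x x) *s x)"
    by simp
  show "hinner x (y - (hinner x y / hinner x x) *s x) = 0"
    using assms by (simp add: hinner_simps) (simp add: hinner_self)
qed

lemma inner_houter: "A \<bullet> houter u x = (A *v x) \<bullet> u"
  by (simp add: houter_def inner_vec_def matrix_vector_mult_def inner_sum_left)
    (simp add: inner_complex_def algebra_simps)

lemma inner_hadjoint: "hadjoint A \<bullet> hadjoint B = A \<bullet> B"
  unfolding inner_vec_def hadjoint_def by (subst sum.swap) (simp add: inner_complex_def)

lemma inner_hadjoint_mult:
  fixes X Y Z :: "complex^'n^'n"
  shows "(Z ** X) \<bullet> Y = X \<bullet> (hadjoint Z ** Y)" "(X ** Z) \<bullet> Y = X \<bullet> (Y ** hadjoint Z)"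
proof -
  have "(Z ** X) \<bullet> Y = Re (\<Sum>i\<in>UNIV. \<Sum>j\<in>UNIV. \<Sum>k\<in>UNIV. cnj (Z $ i $ k * X $ k $ j) * Y $ i $ j)"
    by (simp add: inner_vec_def inner_complex matrix_matrix_mult_def sum_distrib_right)
  also have "\<dots> = Re (\<Sum>k\<in>UNIV. \<Sum>j\<in>UNIV. \<Sum>i\<in>UNIV. cnj (Z $ i $ k * X $ k $ j) * Y $ i $ j)"
    by (subst (2) sum.swap, subst sum.swap, rule arg_cong[where f = Re], rule sum.cong[OF refl], rule sum.swap)
  also have "\<dots> = X \<bullet> (hadjoint Z ** Y)"
    by (simp add: inner_vec_def inner_complex matrix_matrix_mult_def hadjoint_def sum_distrib_left mult_ac)
  finally show "(Z ** X) \<bullet> Y = X \<bullet> (hadjoint Z ** Y)" .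
  have "(X ** Z) \<bullet> Y = Re (\<Sum>i\<in>UNIV. \<Sum>j\<in>UNIV. \<Sum>k\<in>UNIV. cnj (X $ i $ k * Z $ k $ j) * Y $ i $ j)"
    by (simp add: inner_vec_def inner_complex matrix_matrix_mult_def sum_distrib_right)
  also have "\<dots> = Re (\<Sum>i\<in>UNIV. \<Sum>k\<in>UNIV. \<Sum>j\<in>UNIV. cnj (X $ i $ k * Z $ k $ j) * Y $ i $ j)"
    by (rule arg_cong[where f = Re], rule sum.cong[OF refl], rule sum.swap)
  also have "\<dots> = X \<bullet> (Y ** hadjoint Z)"
    by (simp add: inner_vec_def inner_complex matrix_matrix_mult_def hadjoint_def sum_distrib_left mult_ac)
  finally show "(X ** Z) \<bullet> Y = X \<bullet> (Y ** hadjoint Z)" .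
qed

lemma adjoint_lie_bracket_hadjoint: "adjoint (lie_bracket Z) = lie_bracket (hadjoint Z)"
  for Z :: "complex^'n^'n"
  by (intro adjoint_unique)
    (simp add: lie_bracket_def inner_diff_left inner_diff_right
      inner_hadjoint_mult(1)[of Z] inner_hadjoint_mult(2)[of _ Z])

lemma houter_mult: "houter u x ** houter v y = houter (hinner x v *s u) y"
  by (simp add: houter_def hinner_def matrix_matrix_mult_def vec_eq_iff sum_distrib_left
      sum_distrib_right mult_ac)

lemma lie_bracket_houter:
  "lie_bracket (houter u x) (houter v y) = houter (hinner x v *s u) y - houter (hinner y u *s v) x"
  by (simp add: lie_bracket_def houter_mult)

lemma lie_bracket_add:
  "lie_bracket (A + B) C = lie_bracket A C + lie_bracket B C"
  "lie_bracket A (B - C) = lie_bracket A B - lie_bracket A (C :: complex^'n^'n)"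
  by (simp_all add: linear_add[OF lie_bracket_linear(1)] linear_diff[OF lie_bracket_linear(2)])

lemma sum_houter_columns: "K = (\<Sum>j\<in>UNIV. houter (column j K) (axis j 1))"
  by (simp add: vec_eq_iff houter_def column_def axis_def if_distrib cong: if_cong)

text \<open>Up to the factor |x|^2 this is i times the orthogonal projection onto the line of
  \<open>x\<close>: anti-Hermitian, but of nonzero trace unless x = 0.\<close>

definition skew_projection :: "complex^'n \<Rightarrow> complex^'n^'n" where
  "skew_projection x = houter (\<i> *s x) x"

lemma scale_ii: "\<i> *s ((- \<i>) *s u) = u"
  by (simp_all add: vec_eq_iff)

text \<open>Modulo Hermitian matrices, \<open>i (u v\<^sup>* + v u\<^sup>*)\<close> and \<open>2 i u v\<^sup>*\<close> agree, so polarization applies.\<close>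

lemma zero_if_zero_on_skew_projections:
  fixes S :: "complex^'n^'n \<Rightarrow> real"
  assumes S: "linear S" and herm: "\<And>K. hadjoint K = K \<Longrightarrow> S K = 0"
    and proj: "\<And>x. S (skew_projection x) = 0"
  shows "S K = 0"
proof -
  have 1: "S (houter (\<i> *s u) v) = 0" for u v
  proof -
    let ?K = "houter (\<i> *s u) v"
    have 2: "houter (\<i> *s v) u = - hadjoint ?K"
      by (simp add: hadjoint_simps houter_simps)
    have "skew_projection (u + v) = skew_projection u + skew_projection v + ?K + houter (\<i> *s v) u"
      by (simp add: skew_projection_def vector_add_ldistrib houter_simps)
    moreover have "S (?K + hadjoint ?K) = 0"
      by (rule herm) (simp add: hadjoint_simps add.commute)
    ultimately show ?thesis
      using proj[of "u + v"] proj[of u] proj[of v]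
      by (simp add: 2 linear_add[OF S] linear_diff[OF S] linear_neg[OF S])
  qed
  \<comment> \<open>Every vector is i times another one, so all rank-one matrices are covered, and
    splitting \<open>K\<close> into columns finishes.\<close>
  have "S (houter u v) = 0" for u v
    using 1[of "(- \<i>) *s u" v] by (simp only: scale_ii)
  then have "S (\<Sum>j\<in>UNIV. houter (column j K) (axis j 1)) = 0"
    by (simp add: linear_sum[OF S])
  then show ?thesis
    by (simp only: sum_houter_columns[symmetric])
qed

section \<open>Invariant trivectors of the unitary algebra\<close>

text \<open>Invariance is demanded under all anti-Hermitian matrices, not only traceless ones, so
  that \<open>skew_projection x\<close> itself may act.\<close>

locale unitary_trivector = alternating3 T
  for T :: "complex^'n^'n \<Rightarrow> complex^'n^'n \<Rightarrow> complex^'n^'n \<Rightarrow> real" +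
  assumes hermitian: "hadjoint K = K \<Longrightarrow> T K B C = 0"
    and invariant: "hadjoint Z = - Z \<Longrightarrow>
      T (lie_bracket Z A) B C + T A (lie_bracket Z B) C + T A B (lie_bracket Z C) = 0"
    and at_point: "T (houter u x) (houter v x) (houter w x) = 0"
begin

lemma hermitian2: "hadjoint K = K \<Longrightarrow> T A K C = 0"
  and hermitian3: "hadjoint K = K \<Longrightarrow> T A B K = 0"
  using hermitian swap by (metis minus_zero)+

abbreviation "D \<equiv> skew_projection"

lemma hadjoint_D: "hadjoint (D x) = - D x"
  by (simp add: skew_projection_def hadjoint_simps houter_simps)

lemma D_0 [simp]: "D 0 = 0"
  by (simp add: skew_projection_def houter_simps)

text \<open>Bracketing with \<open>D x\<close> kills \<open>D x\<close> and \<open>D y\<close> and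
  sends i u x^* to |x|^2 u x^*, so invariance leaves a single term.\<close>

lemma D_D_houter:
  assumes x: "x \<noteq> 0" and y: "hinner x y = 0" and u: "hinner x u = 0"
  shows "T (D x) (D y) (houter u x) = 0"
proof -
  have yx: "hinner y x = 0" using y by (simp add: hinner_commute[of y])
  have 1: "lie_bracket (D x) (D x) = 0" "lie_bracket (D x) (D y) = 0"
    by (simp_all add: skew_projection_def lie_bracket_houter hinner_simps y yx houter_simps)
  have "- ((\<i> * hinner x x) *s (\<i> *s u)) = (x \<bullet> x) *\<^sub>R u"
    unfolding hinner_self by (simp add: vec_eq_iff complex_eq_iff)
  then have "lie_bracket (D x) (houter (\<i> *s u) x) = (x \<bullet> x) *\<^sub>R houter u x"
    by (simp add: skew_projection_def lie_bracket_houter hinner_simps u houter_simps flip: houter_simps)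
  with invariant[OF hadjoint_D, of x "D x" "D y" "houter (\<i> *s u) x"] x show ?thesis
    by (simp add: 1 scaleR)
qed

text \<open>The cross terms of \<open>D y\<close> are Q - Q^* with \<open>Q\<close> a multiple of y'
  x^*. They equal 2 Q minus the Hermitian matrix Q + Q^*.\<close>

lemma D_orthogonal_part:
  assumes "y = c *s x + y'"
  obtains u where "hadjoint (D y - ((cmod c)\<^sup>2 *\<^sub>R D x + D y' + houter (u *s y') x)) =
    D y - ((cmod c)\<^sup>2 *\<^sub>R D x + D y' + houter (u *s y') x)"
proof
  define Q where "Q = houter ((\<i> * cnj c) *s y') x"
  have "(complex_of_real (cmod c))\<^sup>2 = c * cnj c"
    by (metis complex_norm_square of_real_power)
  then have "D y = (cmod c)\<^sup>2 *\<^sub>R D x + D y' + Q - hadjoint Q"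
    unfolding assms
    by (simp add: vec_eq_iff skew_projection_def Q_def hadjoint_def houter_def algebra_simps
        scaleR_conv_of_real[where 'a = complex])
  moreover have "houter ((2 * \<i> * cnj c) *s y') x = 2 *\<^sub>R Q"
    by (simp add: Q_def vec_eq_iff houter_def scaleR_conv_of_real[where 'a = complex])
  ultimately have "D y - ((cmod c)\<^sup>2 *\<^sub>R D x + D y' + houter ((2 * \<i> * cnj c) *s y') x) = - (Q + hadjoint Q)"
    by (simp add: scaleR_2)
  then show "hadjoint (D y - ((cmod c)\<^sup>2 *\<^sub>R D x + D y' + houter ((2 * \<i> * cnj c) *s y') x)) =
    D y - ((cmod c)\<^sup>2 *\<^sub>R D x + D y' + houter ((2 * \<i> * cnj c) *s y') x)"
    by (simp add: hadjoint_simps add.commute)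
qed

text \<open>Expanding the last two slots modulo Hermitian matrices, further copies of
  \<open>D x\<close> die by alternation, pairs of \<open>houter\<close> terms by
  \<open>at_point\<close>, and single ones by \<open>D_D_houter\<close>.\<close>

lemma D_D_D_orthogonal_parts:
  assumes x: "x \<noteq> 0" and y: "y = c *s x + y'" "hinner x y' = 0"
    and z: "z = d *s x + z'" "hinner x z' = 0"
  shows "T (D x) (D y) (D z) = T (D x) (D y') (D z')"
proof -
  obtain u where u: "\<And>A C. T A (D y - ((cmod c)\<^sup>2 *\<^sub>R D x + D y' + houter (u *s y') x)) C = 0"
    using D_orthogonal_part[OF y(1)] hermitian2 by metis
  obtain v where v: "\<And>A B. T A B (D z - ((cmod d)\<^sup>2 *\<^sub>R D x + D z' + houter (v *s z') x)) = 0"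
    using D_orthogonal_part[OF z(1)] hermitian3 by metis
  have "T (D x) (houter a x) (houter b x) = 0" for a b
    unfolding skew_projection_def by (rule at_point)
  moreover have "T (D x) (D y') (houter (v *s z') x) = 0" "T (D x) (D z') (houter (u *s y') x) = 0"
    by (rule D_D_houter; simp add: x y z hinner_simps)+
  moreover have "T (D x) (houter (u *s y') x) (D z') = - T (D x) (D z') (houter (u *s y') x)"
    by (rule swap)
  ultimately show ?thesis
    using u[of "D x" "D z"] v[of "D x" "(cmod c)\<^sup>2 *\<^sub>R D x + D y' + houter (u *s y') x"]
    by (simp add: diff add scaleR)
qed

text \<open>Invariance under \<open>Z\<close> is applied to (D x, D y, W). \<open>Z\<close> commutes
  with \<open>D x\<close>, [Z, D y] is a multiple of \<open>W\<close>, and [Z, W] is a combination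
  of \<open>D z\<close> and \<open>D y\<close>. Alternation leaves only 2 |y|^2 T (D x) (D y) (D
  z).\<close>

lemma D_D_D_orthogonal:
  assumes xy: "hinner x y = 0" and xz: "hinner x z = 0" and yz: "hinner y z = 0" and y: "y \<noteq> 0"
  shows "T (D x) (D y) (D z) = 0"
proof -
  have o: "hinner y x = 0" "hinner z x = 0" "hinner z y = 0"
    using xy xz yz by (simp_all add: hinner_commute[of y x] hinner_commute[of z])
  define Z where "Z = houter (\<i> *s y) z + houter (\<i> *s z) y"
  define W where "W = houter y z - houter z y"
  note s = skew_projection_def Z_def W_def lie_bracket_add lie_bracket_houter hinner_simps
    xy xz yz o hinner_self
  have "hadjoint Z = - Z"
    by (simp add: Z_def hadjoint_simps houter_simps)
  note inv = invariant[OF this, of "D x" "D y" W]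
  have "lie_bracket Z (D x) = 0"
    by (simp add: s houter_simps)
  moreover have "lie_bracket Z (D y) = (y \<bullet> y) *\<^sub>R W"
    by (simp add: s houter_simps) (simp add: vec_eq_iff houter_def scaleR_conv_of_real[where 'a = complex] algebra_simps)
  moreover have "lie_bracket Z W = (2 * (y \<bullet> y)) *\<^sub>R D z - (2 * (z \<bullet> z)) *\<^sub>R D y"
    by (simp add: s houter_simps) (simp add: vec_eq_iff houter_def scaleR_conv_of_real[where 'a = complex] algebra_simps)
  ultimately show ?thesis
    using inv y by (simp add: diff scaleR)
qed

text \<open>A Gram-Schmidt reduction to orthogonal vectors; a vanishing vector on the way is
  harmless because D 0 = 0.\<close>

lemma D_D_D: "T (D x) (D y) (D z) = 0"
proof (cases "x = 0")
  case x: False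
  obtain c y' where y: "y = c *s x + y'" "hinner x y' = 0"
    using orthogonal_decomposition[OF x] by blast
  obtain d z' where z: "z = d *s x + z'" "hinner x z' = 0"
    using orthogonal_decomposition[OF x] by blast
  have 1: "T (D x) (D y) (D z) = T (D x) (D y') (D z')"
    by (rule D_D_D_orthogonal_parts[OF x y z])
  show ?thesis
  proof (cases "y' = 0")
    case y': False
    obtain e z'' where z': "z' = e *s y' + z''" "hinner y' z'' = 0"
      using orthogonal_decomposition[OF y'] by blast
    have o: "hinner y' x = 0" "hinner x z'' = 0"
      using y(2) z(2) z'(1) by (simp_all add: hinner_commute[of y' x] hinner_simps)
    \<comment> \<open>Now \<open>y'\<close> is the base vector, and \<open>x\<close>, being
      orthogonal to it, is its own orthogonal part with coefficient 0.\<close>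
    have "T (D y') (D x) (D z') = T (D y') (D x) (D z'')"
      by (rule D_D_D_orthogonal_parts[OF y' _ o(1) z', of x 0]) (simp add: vec_eq_iff)
    also have "\<dots> = 0"
      using D_D_D_orthogonal[OF y(2) o(2) z'(2) y'] swap(1)[of "D y'" "D x"] by simp
    finally show ?thesis
      using 1 swap(1)[of "D x" "D y'"] by simp
  qed (simp add: 1)
qed simp

text \<open>The slots are freed one at a time, from the last to the first, each being a linear
  functional that kills Hermitian matrices.\<close>

lemma zero_everywhere: "T A B C = 0"
proof -
  have "T (D x) (D y) K = 0" for x y K
    using zero_if_zero_on_skew_projections[OF linear(3) hermitian3 D_D_D] .
  then have "T (D x) B K = 0" for x B K
    using zero_if_zero_on_skew_projections[OF linear(2) hermitian2] by blast
  then show ?thesis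
    using zero_if_zero_on_skew_projections[OF linear(1) hermitian] by blast
qed

end

lemma lie_bracket_mat: "lie_bracket (mat c) A = 0"
  for A :: "complex^'n^'n"
  by (simp add: lie_bracket_def vec_eq_iff matrix_matrix_mult_def mat_def if_distrib
      if_distribR mult.commute cong: if_cong)

section \<open>Poisson and triangular r-matrices for the special unitary algebra\<close>

lemma poisson_su_iff:
  fixes r :: "(complex^'n^'n) tensor2"
  assumes s: "simple_lie_algebra (su_algebra :: (complex^'n^'n) set)"
    and r: "classical_r_matrix su_algebra r"
  shows "poisson (fundamental_field r) \<longleftrightarrow> triangular r"
proof -
  have w: "r \<in> Wedge2 su_algebra" using r by (simp add: classical_r_matrix_def)
  note t = schouten_classical_r_matrix[OF s r]
  interpret alternating3 "coeff3 (schouten r r)" using t by (rule alternating3_coeff3)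
  have a: "adjoint (\<lambda>A. A *v x) = (\<lambda>u. houter u x)" for x :: "complex^'n"
    by (intro adjoint_unique) (simp add: inner_houter)
  have p: "poisson (fundamental_field r) \<longleftrightarrow>
    (\<forall>x u v w. coeff3 (schouten r r) (houter u x) (houter v x) (houter w x) = 0)"
    unfolding poisson_fundamental_field_iff[OF w] a ..
  have "schouten r r = 0" if "poisson (fundamental_field r)"
  proof (rule coeff3_eqI)
    interpret unitary_trivector "coeff3 (schouten r r)"
    proof
      fix K B C :: "complex^'n^'n"
      assume K: "hadjoint K = K"
      have "X \<bullet> K = 0" if "X \<in> su_algebra" for X
        using that inner_hadjoint[of X K] by (simp add: su_algebra_iff K)
      then show "coeff3 (schouten r r) K B C = 0"
        by (rule coeff3_orthogonal[OF t])
    next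
      fix Z A B C :: "complex^'n^'n"
      assume Z: "hadjoint Z = - Z"
      \<comment> \<open>The trace of an anti-Hermitian matrix is imaginary, so subtracting
        \<open>mat c\<close> lands in \<open>su_algebra\<close>; brackets do not see the scalar
        part.\<close>
      define c where "c = trace Z / of_nat CARD('n)"
      have "cnj (trace Z) = - trace Z"
        using Z by (simp add: trace_def hadjoint_def vec_eq_iff sum_negf)
      then have c: "cnj c = - c" "of_nat CARD('n) * c = trace Z"
        by (simp_all add: c_def)
      define Z' where "Z' = Z - mat c"
      have h: "hadjoint Z' = - Z'"
        using Z c(1) by (simp add: Z'_def hadjoint_def vec_eq_iff mat_def)
      moreover have "trace Z' = 0"
        using c(2) by (simp add: Z'_def trace_def mat_def sum_subtractf)
      ultimately have i: "ad3 Z' (schouten r r) = 0"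
        using r by (auto simp: classical_r_matrix_def su_algebra_iff)
      have "adjoint (lie_bracket Z') K = - lie_bracket Z K" for K
        unfolding adjoint_lie_bracket_hadjoint h
        by (simp add: Z'_def linear_neg[OF lie_bracket_linear(1)] linear_diff[OF lie_bracket_linear(1)]
            lie_bracket_mat)
      then show "coeff3 (schouten r r) (lie_bracket Z A) B C + coeff3 (schouten r r) A (lie_bracket Z B) C
          + coeff3 (schouten r r) A B (lie_bracket Z C) = 0"
        using coeff3_ad3[OF t, of Z' A B C] by (simp add: i coeff3_simps minus)
    next
      show "coeff3 (schouten r r) (houter u x) (houter v x) (houter w x) = 0" for u v w x
        using that p by blast
    qed
    show "coeff3 (schouten r r) A B C = coeff3 0 A B C" for A B C
      by (simp add: zero_everywhere coeff3_simps)
  qed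
  moreover have "poisson (fundamental_field r)" if "schouten r r = 0"
    unfolding p that by (simp add: coeff3_simps)
  ultimately show ?thesis
    unfolding triangular_def by blast
qed

theorem proposition4p4:
  shows "(simple_lie_algebra (so_algebra :: (real^'n::finite^'n) set) \<longrightarrow>
            (\<forall>r. classical_r_matrix (so_algebra :: (real^'n^'n) set) r \<longrightarrow>
                 poisson (fundamental_field r)))
       \<and> (simple_lie_algebra (sl_algebra :: (real^'n^'n) set) \<longrightarrow>
            (\<forall>r. classical_r_matrix (sl_algebra :: (real^'n^'n) set) r \<longrightarrow>
                 poisson (fundamental_field r)))
       \<and> (simple_lie_algebra (sp_algebra :: (real^('n + 'n)^('n + 'n)) set) \<longrightarrow>
            (\<forall>r. classical_r_matrix (sp_algebra :: (real^('n + 'n)^('n + 'n)) set) r \<longrightarrow>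
                 poisson (fundamental_field r)))
       \<and> (simple_lie_algebra (su_algebra :: (complex^'n^'n) set) \<longrightarrow>
            (\<forall>r. classical_r_matrix (su_algebra :: (complex^'n^'n) set) r \<longrightarrow>
                 (poisson (fundamental_field r) \<longleftrightarrow> triangular r)))"
  using poisson_so poisson_sl poisson_sp poisson_su_iff by blast

end
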